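(* Let Standing Assumption 1 and Assumption 3 hold and let $\sigma\in C^1(\mathbb R)$. For each $\varepsilon>0$ let $\theta_\varepsilon$ be an $\varepsilon$-approximating network (of some architecture). Then there exist $\varepsilon_1>0$ and $c>0$ such that for all $0<\varepsilon<\varepsilon_1$ and all $y_0\in Y_0$ the closed-loop system $$\dot y=f(y)+BF^\sigma_{\theta_\varepsilon}(y),\qquad y(0)=y_0,$$ has a unique solution $\mathbf y_\varepsilon(y_0)\in\mathcal Y_{ad}$, which satisfies $\|y^*(y_0)-\mathbf y_\varepsilon(y_0)\|_{W_\infty}\le c\varepsilon$ and $\|\mathbf y_\varepsilon(y_0)\|_{W_\infty}\le\frac32M|y_0|$. Moreover $\mathbf y_\varepsilon\in L^\infty_\mu(Y_0;W_\infty)$ with $\|\mathbf y_\varepsilon\|_{L^\infty_\mu(Y_0;W_\infty)}\le\frac32M_{Y_0}$.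
   Context: $I=[0,\infty)$, $W_\infty=\{y\in L^2(I;\mathbb R^n):\dot y\in L^2(I;\mathbb R^n)\}$ with norm $\|y\|_{W_\infty}=(\|y\|_{L^2}^2+\|\dot y\|_{L^2}^2)^{1/2}$; $C_\imath>0$ is a constant with $\sup_{t\ge0}|y(t)|\le C_\imath\|y\|_{W_\infty}$. Given $f:\mathbb R^n\to\mathbb R^n$, $B\in\mathbb R^{n\times m}$, positive semidefinite $Q$, $\beta>0$, problem $(P^{y_0}_\beta)$ is: minimize $\frac12\int_0^\infty(|Qy|^2+\beta|u|^2)dt$ over $(y,u)\in W_\infty\times L^2(I;\mathbb R^m)$ with $\dot y=f(y)+Bu$, $y(0)=y_0$. Standing Assumption 1: $Y_0\subset\mathbb R^n$ is compact with $0\in Y_0$, and (A.1) $f\in C^1$, $f(0)=0$, $Df$ Lipschitz on compact sets; (A.2) there exist an open neighbourhood $\mathcal N(Y_0)$ of $Y_0$ and $F^*:\mathcal N(Y_0)\to\mathbb R^m$, $F^*(0)=0$, such that for every $y_0\in\mathcal N(Y_0)$ the closed-loop system $\dot y=f(y)+BF^*(y)$, $y(0)=y_0$ has a unique solution $y^*(y_0)\in W_\infty$ and $(y^*(y_0),F^*(y^*(y_0)))$ minimizes $(P^{y_0}_\beta)$; (A.3) $y_0\mapsto y^*(y_0)$ is continuously Fréchet differentiable from $\mathcal N(Y_0)$ to $W_\infty$ and $\|y^*(y_0)\|_{W_\infty}\le M|y_0|$ for some $M>0$ and all $y_0\in\mathcal N(Y_0)$. Set $M_{Y_0}=M\max_{y_0\in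 Y_0}|y_0|$, $\widehat M=C_\imath M_{Y_0}$, $\mathcal Y_{ad}=\{y\in W_\infty:\|y\|_{W_\infty}\le2M_{Y_0}\}$; (A.4) $F^*$ extends to a $C^1$ map on $\bar B_{2\widehat M}(0)$ with Lipschitz derivative there. Assumption 3: there is $C>0$ such that for every $y_0\in\mathcal N(Y_0)$, $\delta y_0\in\mathbb R^n$ and $\delta v\in L^2(I;\mathbb R^n)$ there is a unique $\delta y\in W_\infty$ with $\dot{\delta y}=Df(y^*(y_0))\delta y+B\,DF^*(y^*(y_0))\delta y+\delta v$, $\delta y(0)=\delta y_0$, and $\|\delta y\|_{W_\infty}\le C(\|\delta v\|_{L^2}+|\delta y_0|)$. $(Y_0,\mathcal A,\mu)$ is a complete probability space whose $\sigma$-algebra contains the Borel sets; $L^\infty_\mu(Y_0;W_\infty)$ is the Bochner space of strongly measurable essentially bounded $W_\infty$-valued functions. Networks: $\theta=(W_1,b_1,\dots,W_L,b_L)$ with $W_i\in\mathbb R^{N_i\times N_{i-1}}$, $b_i\in\mathbb R^{N_i}$, $N_0=n$, $N_L=m$; $f_{i,\theta}(x)=\sigma(W_ix+b_i)$ ($\sigma$ componentwise) for $i<L$, $f_{L,\theta}(x)=W_Lx+b_L$, $\Psi_\theta=f_{L,\theta}\circ\dots\circ f_{1,\theta}$, realization $F^\sigma_\theta(x)=\Psi_\theta(x)-\Psi_\theta(0)$. A network $\theta$ is $\varepsilon$-approximating if $|F^*(x)-F^\sigma_\theta(x)|+\|DF^*(x)-DF^\sigma_\theta(x)\|\le\varepsilon$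 for all $|x|\le2\widehat M$. *)

theory Defs
  imports "HOL-Probability.Probability"
begin

text \<open>Functions on I are represented as total functions real => 'a; only their
values on {0..} matter.  Elements of W_infinity are represented by their
(absolutely) continuous representative.\<close>

definition sq_int :: "(real \<Rightarrow> 'a::euclidean_space) \<Rightarrow> bool" where
  "sq_int g \<longleftrightarrow> set_borel_measurable lborel {0..} g \<and>
                 set_integrable lborel {0..} (\<lambda>t. (norm (g t))\<^sup>2)"

definition L2norm :: "(real \<Rightarrow> 'a::euclidean_space) \<Rightarrow> real" where
  "L2norm g = sqrt (LINT t:{0..}|lborel. (norm (g t))\<^sup>2)"

definition is_wderiv :: "(real \<Rightarrow> 'a::euclidean_space) \<Rightarrow> (real \<Rightarrow> 'a) \<Rightarrow> bool" where
  "is_wderiv y g \<longleftrightarrow>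
     (\<forall>t\<ge>0. set_integrable lborel {0..t} g \<and> y t = y 0 + (LINT s:{0..t}|lborel. g s))"

definition Winf :: "(real \<Rightarrow> 'a::euclidean_space) \<Rightarrow> bool" where
  "Winf y \<longleftrightarrow> sq_int y \<and> (\<exists>g. is_wderiv y g \<and> sq_int g)"

definition wderiv :: "(real \<Rightarrow> 'a::euclidean_space) \<Rightarrow> (real \<Rightarrow> 'a)" where
  "wderiv y = (SOME g. is_wderiv y g \<and> sq_int g)"

definition Wnorm :: "(real \<Rightarrow> 'a::euclidean_space) \<Rightarrow> real" where
  "Wnorm y = sqrt ((L2norm y)\<^sup>2 + (L2norm (wderiv y))\<^sup>2)"

definition unique_on_I :: "((real \<Rightarrow> 'a) \<Rightarrow> bool) \<Rightarrow> bool" where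
  "unique_on_I P \<longleftrightarrow> (\<exists>y. P y \<and> (\<forall>z. P z \<longrightarrow> (\<forall>t\<ge>0. z t = y t)))"

definition state_eq ::
  "('a::euclidean_space \<Rightarrow> 'a) \<Rightarrow> ('b::euclidean_space \<Rightarrow> 'a) \<Rightarrow> 'a \<Rightarrow> (real \<Rightarrow> 'a) \<Rightarrow> (real \<Rightarrow> 'b) \<Rightarrow> bool" where
  "state_eq f B y0 y u \<longleftrightarrow> Winf y \<and> y 0 = y0 \<and> is_wderiv y (\<lambda>t. f (y t) + B (u t))"

definition admissible ::
  "('a::euclidean_space \<Rightarrow> 'a) \<Rightarrow> ('b::euclidean_space \<Rightarrow> 'a) \<Rightarrow> 'a \<Rightarrow> (real \<Rightarrow> 'a) \<Rightarrow> (real \<Rightarrow> 'b) \<Rightarrow> bool" where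
  "admissible f B y0 y u \<longleftrightarrow> state_eq f B y0 y u \<and> sq_int u"

definition cost :: "('a::euclidean_space \<Rightarrow> 'a) \<Rightarrow> real \<Rightarrow> (real \<Rightarrow> 'a) \<Rightarrow> (real \<Rightarrow> 'b::euclidean_space) \<Rightarrow> real" where
  "cost Q \<beta> y u = (1/2) * (LINT t:{0..}|lborel. (norm (Q (y t)))\<^sup>2 + \<beta> * (norm (u t))\<^sup>2)"

definition is_minimizer ::
  "('a::euclidean_space \<Rightarrow> 'a) \<Rightarrow> ('b::euclidean_space \<Rightarrow> 'a) \<Rightarrow> ('a \<Rightarrow> 'a) \<Rightarrow> real \<Rightarrow> 'a
     \<Rightarrow> (real \<Rightarrow> 'a) \<Rightarrow> (real \<Rightarrow> 'b) \<Rightarrow> bool" where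
  "is_minimizer f B Q \<beta> y0 y u \<longleftrightarrow> admissible f B y0 y u \<and>
     (\<forall>y' u'. admissible f B y0 y' u' \<longrightarrow> cost Q \<beta> y u \<le> cost Q \<beta> y' u')"

definition cl_sol ::
  "('a::euclidean_space \<Rightarrow> 'a) \<Rightarrow> ('b::euclidean_space \<Rightarrow> 'a) \<Rightarrow> ('a \<Rightarrow> 'b) \<Rightarrow> 'a \<Rightarrow> (real \<Rightarrow> 'a) \<Rightarrow> bool" where
  "cl_sol f B F y0 y \<longleftrightarrow> state_eq f B y0 y (\<lambda>t. F (y t))"

definition basis_enum :: "nat \<Rightarrow> 'a::euclidean_space" where
  "basis_enum = (SOME e. bij_betw e {..<DIM('a)} Basis)"

text \<open>A network is the list of its layers (N_i, W_i, b_i), i = 1..L; vectors of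
R^{N_i} are represented as nat => real (only the first N_i entries are used).\<close>
type_synonym network = "(nat \<times> (nat \<Rightarrow> nat \<Rightarrow> real) \<times> (nat \<Rightarrow> real)) list"

fun eval_layers :: "(real \<Rightarrow> real) \<Rightarrow> nat \<Rightarrow> network \<Rightarrow> (nat \<Rightarrow> real) \<Rightarrow> (nat \<Rightarrow> real)" where
  "eval_layers \<sigma> Np [] h = h"
| "eval_layers \<sigma> Np [(N, W, b)] h = (\<lambda>i. (\<Sum>j<Np. W i j * h j) + b i)"
| "eval_layers \<sigma> Np ((N, W, b) # l # rest) h =
     eval_layers \<sigma> N (l # rest) (\<lambda>i. \<sigma> ((\<Sum>j<Np. W i j * h j) + b i))"

definition valid_net :: "'a::euclidean_space itself \<Rightarrow> 'b::euclidean_space itself \<Rightarrow> network \<Rightarrow> bool" where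
  "valid_net _ _ \<theta> \<longleftrightarrow> \<theta> \<noteq> [] \<and> fst (last \<theta>) = DIM('b)"

definition Psi :: "(real \<Rightarrow> real) \<Rightarrow> network \<Rightarrow> 'a::euclidean_space \<Rightarrow> 'b::euclidean_space" where
  "Psi \<sigma> \<theta> x = (\<Sum>i<DIM('b).
      eval_layers \<sigma> DIM('a) \<theta> (\<lambda>j. x \<bullet> (basis_enum j :: 'a)) i *\<^sub>R (basis_enum i :: 'b))"

definition Fnet :: "(real \<Rightarrow> real) \<Rightarrow> network \<Rightarrow> 'a::euclidean_space \<Rightarrow> 'b::euclidean_space" where
  "Fnet \<sigma> \<theta> x = Psi \<sigma> \<theta> x - (Psi \<sigma> \<theta> (0::'a) :: 'b)"

definition eps_approx ::
  "('a::euclidean_space \<Rightarrow> 'b::euclidean_space) \<Rightarrow> ('a \<Rightarrow> 'a \<Rightarrow> 'b) \<Rightarrow> (real \<Rightarrow> real) \<Rightarrow> real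
     \<Rightarrow> network \<Rightarrow> real \<Rightarrow> bool" where
  "eps_approx F DF \<sigma> Mhat \<theta> \<epsilon> \<longleftrightarrow> valid_net TYPE('a) TYPE('b) \<theta> \<and>
     (\<forall>x::'a. norm x \<le> 2 * Mhat \<longrightarrow>
        norm (F x - Fnet \<sigma> \<theta> x) +
        onorm (\<lambda>h. DF x h - frechet_derivative (Fnet \<sigma> \<theta> :: 'a \<Rightarrow> 'b) (at x) h) \<le> \<epsilon>)"

definition strongly_measurable_W :: "'x measure \<Rightarrow> ('x \<Rightarrow> real \<Rightarrow> 'a::euclidean_space) \<Rightarrow> bool" where
  "strongly_measurable_W \<mu> g \<longleftrightarrow> (\<forall>x\<in>space \<mu>. Winf (g x)) \<and>
     (\<exists>s :: nat \<Rightarrow> 'x \<Rightarrow> real \<Rightarrow> 'a.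
        (\<forall>k. finite (s k ` space \<mu>) \<and> (\<forall>x\<in>space \<mu>. Winf (s k x)) \<and>
             (\<forall>v. {x \<in> space \<mu>. s k x = v} \<in> sets \<mu>)) \<and>
        (AE x in \<mu>. (\<lambda>k. Wnorm (s k x - g x)) \<longlonglongrightarrow> 0))"

definition Linf_W_norm :: "'x measure \<Rightarrow> ('x \<Rightarrow> real \<Rightarrow> 'a::euclidean_space) \<Rightarrow> ereal" where
  "Linf_W_norm \<mu> g = esssup \<mu> (\<lambda>x. ereal (Wnorm (g x)))"

definition in_Linf_W :: "'x measure \<Rightarrow> ('x \<Rightarrow> real \<Rightarrow> 'a::euclidean_space) \<Rightarrow> bool" where
  "in_Linf_W \<mu> g \<longleftrightarrow> strongly_measurable_W \<mu> g \<and> Linf_W_norm \<mu> g < \<infinity>"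

end

theory Submission
  imports Defs
begin

text \<open>Write \<open>H = f + B F\<^sup>*\<close> and \<open>G = f + B F\<^sub>\<theta>\<close>. On the ball of radius \<open>2 Mhat\<close> the difference \<open>G - H\<close>
  vanishes at the origin and has Lipschitz constant \<open>\<eta> = b \<epsilon>\<close>, where \<open>b\<close> bounds \<open>B\<close>. The
  correction \<open>w = y - y\<^sup>*\<close> solves \<open>w' = DH(y\<^sup>*) w + R(w)\<close> with \<open>w(0) = 0\<close>, where
  \<open>R(w) = G(y\<^sup>* + w) - H(y\<^sup>*) - DH(y\<^sup>*) w\<close> is Lipschitz with a small constant near \<open>0\<close> and
  \<open>|R(0)| \<le> \<eta> |y\<^sup>*|\<close>. Assumption 3 inverts the linear part, so Picard iteration contracts on the ball of
  radius \<open>2 C \<eta> M |y\<^sub>0|\<close>; this radius is both \<open>O(\<epsilon>)\<close> and at most \<open>M |y\<^sub>0| / 2\<close>. The iterates converge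
  uniformly by the embedding, and Fatou's lemma puts the limit into \<open>L\<^sup>2\<close>. Uniqueness is Gronwall's lemma. Assumption 3 applied to the
  difference of two solutions shows that the solution map is locally Lipschitz in the initial
  value, which gives strong measurability on the compact set \<open>Y\<^sub>0\<close>.\<close>

section \<open>Square integrable functions on the half line\<close>

lemma sq_intD:
  assumes "sq_int g"
  shows "(\<lambda>t. indicator {0..} t *\<^sub>R g t) \<in> borel_measurable lborel"
    and "integrable lborel (\<lambda>t. (norm (indicator {0..} t *\<^sub>R g t))\<^sup>2)"
proof -
  show "(\<lambda>t. indicator {0..} t *\<^sub>R g t) \<in> borel_measurable lborel"
    using assms by (simp add: sq_int_def set_borel_measurable_def)
  have "(\<lambda>t. indicator {0..} t *\<^sub>R (norm (g t))\<^sup>2) = (\<lambda>t. (norm (indicator {0..} t *\<^sub>R g t))\<^sup>2)"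
    by (auto simp: indicator_def)
  then show "integrable lborel (\<lambda>t. (norm (indicator {0..} t *\<^sub>R g t))\<^sup>2)"
    using assms by (simp add: sq_int_def set_integrable_def)
qed

lemma L2norm_sq: "(L2norm g)\<^sup>2 = (LINT t|lborel. (norm (indicator {0..} t *\<^sub>R g t))\<^sup>2)"
proof -
  have "(\<lambda>t. indicator {0..} t *\<^sub>R (norm (g t))\<^sup>2) = (\<lambda>t. (norm (indicator {0..} t *\<^sub>R g t))\<^sup>2)"
    by (auto simp: indicator_def)
  then show ?thesis
    by (simp add: L2norm_def set_lebesgue_integral_def)
qed

lemma L2norm_nonneg [simp]: "0 \<le> L2norm g"
  by (auto simp: L2norm_def set_lebesgue_integral_def intro!: integral_nonneg_AE)

lemma Wnorm_nonneg [simp]: "0 \<le> Wnorm y"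
  by (simp add: Wnorm_def)

lemma L2norm_le_Wnorm: "L2norm y \<le> Wnorm y"
  unfolding Wnorm_def by (rule real_le_rsqrt) simp

lemma sq_int_mono:
  fixes g :: "real \<Rightarrow> 'a::euclidean_space" and h :: "real \<Rightarrow> 'b::euclidean_space"
  assumes g: "set_borel_measurable lborel {0..} g" and h: "sq_int h"
    and le: "\<And>t. t \<ge> 0 \<Longrightarrow> norm (g t) \<le> norm (h t)"
  shows "sq_int g" and "L2norm g \<le> L2norm h"
proof -
  have gm: "(\<lambda>t. indicator {0..} t *\<^sub>R g t) \<in> borel_measurable lborel"
    using g by (simp add: set_borel_measurable_def)
  have i: "integrable lborel (\<lambda>t. (norm (indicator {0..} t *\<^sub>R g t))\<^sup>2)"
    by (rule Bochner_Integration.integrable_bound[OF sq_intD(2)[OF h]])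
      (use gm in measurable, auto simp: indicator_def intro!: power_mono le)
  have e: "(\<lambda>t. indicator {0..} t *\<^sub>R (norm (g t))\<^sup>2) = (\<lambda>t. (norm (indicator {0..} t *\<^sub>R g t))\<^sup>2)"
    by (auto simp: indicator_def)
  show "sq_int g"
    unfolding sq_int_def set_integrable_def e using g i by blast
  have "(L2norm g)\<^sup>2 \<le> (L2norm h)\<^sup>2"
    unfolding L2norm_sq
    by (rule integral_mono[OF i sq_intD(2)[OF h]]) (auto simp: indicator_def intro!: power_mono le)
  then show "L2norm g \<le> L2norm h"
    by (rule power2_le_imp_le) simp
qed

lemma sq_int_scaleR:
  fixes g :: "real \<Rightarrow> 'a::euclidean_space"
  assumes "sq_int g"
  shows "sq_int (\<lambda>t. c *\<^sub>R g t)" and "L2norm (\<lambda>t. c *\<^sub>R g t) = \<bar>c\<bar> * L2norm g"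
proof -
  have m: "(\<lambda>t. indicator {0..} t *\<^sub>R (c *\<^sub>R g t)) \<in> borel_measurable lborel"
    using borel_measurable_scaleR[OF borel_measurable_const[of c] sq_intD(1)[OF assms]]
    by (simp add: ac_simps)
  have "set_integrable lborel {0..} (\<lambda>t. (norm (c *\<^sub>R g t))\<^sup>2)"
    using assms by (simp add: sq_int_def power_mult_distrib)
  with m show "sq_int (\<lambda>t. c *\<^sub>R g t)"
    by (simp add: sq_int_def set_borel_measurable_def)
  show "L2norm (\<lambda>t. c *\<^sub>R g t) = \<bar>c\<bar> * L2norm g"
    by (simp add: L2norm_def power_mult_distrib real_sqrt_mult)
qed

text \<open>Once \<open>norm (a + b)\<close> is replaced by \<open>norm a + norm b\<close>, the gap
  between the two sides is the square of \<open>q * norm a - p * norm b\<close> divided by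
  \<open>p * q\<close>. It closes when the weights are proportional to the norms, so the bound is
  sharp enough for Minkowski.\<close>

lemma norm_add_sq_le_weighted:
  fixes a b :: "'a::real_inner"
  assumes "p > 0" "q > 0"
  shows "(norm (a + b))\<^sup>2 \<le> (p + q) * ((norm a)\<^sup>2 / p + (norm b)\<^sup>2 / q)"
proof -
  have "(norm (a + b))\<^sup>2 \<le> (norm a + norm b)\<^sup>2"
    by (intro power_mono norm_triangle_ineq) simp
  also have "\<dots> \<le> (p + q) * ((norm a)\<^sup>2 / p + (norm b)\<^sup>2 / q)"
  proof -
    have "(p + q) * ((norm a)\<^sup>2 / p + (norm b)\<^sup>2 / q) - (norm a + norm b)\<^sup>2
        = (q * norm a - p * norm b)\<^sup>2 / (p * q)"
      using assms by (simp add: field_simps power2_eq_square)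
    also have "\<dots> \<ge> 0" using assms by simp
    finally show ?thesis by simp
  qed
  finally show ?thesis .
qed

text \<open>Minkowski: integrate the weighted inequality above with the weights
  \<open>p = \<parallel>g\<parallel>\<close> and \<open>q = \<parallel>h\<parallel>\<close>, perturbed by \<open>e\<close> to stay positive.\<close>

lemma sq_int_add:
  fixes g h :: "real \<Rightarrow> 'a::euclidean_space"
  assumes g: "sq_int g" and h: "sq_int h"
  shows "sq_int (\<lambda>t. g t + h t)" and "L2norm (\<lambda>t. g t + h t) \<le> L2norm g + L2norm h"
proof -
  let ?G = "\<lambda>t. indicator {0..} t *\<^sub>R g t" and ?H = "\<lambda>t. indicator {0..} t *\<^sub>R h t"
  have eq: "(\<lambda>t. indicator {0..} t *\<^sub>R (g t + h t)) = (\<lambda>t. ?G t + ?H t)"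
    by (simp add: scaleR_add_right)
  have m: "(\<lambda>t. ?G t + ?H t) \<in> borel_measurable lborel"
    using sq_intD(1)[OF g] sq_intD(1)[OF h] by measurable
  have wi: "integrable lborel (\<lambda>t. (p + q) * ((norm (?G t))\<^sup>2 / p + (norm (?H t))\<^sup>2 / q))" for p q :: real
    by (intro integrable_mult_right Bochner_Integration.integrable_add integrable_divide
        sq_intD(2) g h)
  \<comment> \<open>Unit weights give the crude bound by twice the sum of the squares, which is
    enough for integrability.\<close>
  have i: "integrable lborel (\<lambda>t. (norm (?G t + ?H t))\<^sup>2)"
  proof (rule Bochner_Integration.integrable_bound[OF wi[of 1 1]])
    show "(\<lambda>t. (norm (?G t + ?H t))\<^sup>2) \<in> borel_measurable lborel"
      using m by measurable
    show "AE t in lborel. norm ((norm (?G t + ?H t))\<^sup>2)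
        \<le> norm ((1 + 1) * ((norm (?G t))\<^sup>2 / 1 + (norm (?H t))\<^sup>2 / 1))"
    proof (rule AE_I2)
      fix t
      show "norm ((norm (?G t + ?H t))\<^sup>2)
          \<le> norm ((1 + 1) * ((norm (?G t))\<^sup>2 / 1 + (norm (?H t))\<^sup>2 / 1))"
        using norm_add_sq_le_weighted[of 1 1 "?G t" "?H t"]
        by (simp only: real_norm_def) (rule order_trans[OF _ abs_ge_self], simp)
    qed
  qed
  have e: "(\<lambda>t. indicator {0..} t *\<^sub>R (norm (g t + h t))\<^sup>2) = (\<lambda>t. (norm (?G t + ?H t))\<^sup>2)"
    by (auto simp: indicator_def)
  show "sq_int (\<lambda>t. g t + h t)"
    unfolding sq_int_def set_borel_measurable_def set_integrable_def e eq using m i by simp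
  have sqle: "(L2norm (\<lambda>t. g t + h t))\<^sup>2 \<le> (p + q) * ((L2norm g)\<^sup>2 / p + (L2norm h)\<^sup>2 / q)"
    if pq: "p > 0" "q > 0" for p q
  proof -
    have "(L2norm (\<lambda>t. g t + h t))\<^sup>2 = (LINT t|lborel. (norm (?G t + ?H t))\<^sup>2)"
      unfolding L2norm_sq by (simp only: scaleR_add_right)
    also have "\<dots> \<le> (LINT t|lborel. (p + q) * ((norm (?G t))\<^sup>2 / p + (norm (?H t))\<^sup>2 / q))"
      by (rule integral_mono[OF i wi]) (rule norm_add_sq_le_weighted[OF pq])
    also have "\<dots> = (p + q) * ((L2norm g)\<^sup>2 / p + (L2norm h)\<^sup>2 / q)"
      unfolding L2norm_sq using sq_intD(2)[OF g] sq_intD(2)[OF h] by simp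
    finally show ?thesis .
  qed
  show "L2norm (\<lambda>t. g t + h t) \<le> L2norm g + L2norm h"
  proof (rule field_le_epsilon)
    fix e :: real assume "e > 0"
    define p where "p = L2norm g + e / 2"
    define q where "q = L2norm h + e / 2"
    have pq: "p > 0" "q > 0" using \<open>e > 0\<close> by (simp_all add: p_def q_def add_nonneg_pos)
    have "(L2norm g)\<^sup>2 / p \<le> p" "(L2norm h)\<^sup>2 / q \<le> q"
      using pq \<open>e > 0\<close>
      by (auto simp: divide_le_eq power2_eq_square p_def q_def intro!: mult_mono)
    then have "(p + q) * ((L2norm g)\<^sup>2 / p + (L2norm h)\<^sup>2 / q) \<le> (p + q) * (p + q)"
      using pq by (intro mult_left_mono) auto
    with sqle[OF pq] have "(L2norm (\<lambda>t. g t + h t))\<^sup>2 \<le> (p + q)\<^sup>2"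
      by (simp add: power2_eq_square)
    then have "L2norm (\<lambda>t. g t + h t) \<le> p + q"
      by (rule power2_le_imp_le) (use pq in simp)
    then show "L2norm (\<lambda>t. g t + h t) \<le> L2norm g + L2norm h + e"
      by (simp add: p_def q_def)
  qed
qed

lemma sq_int_uminus:
  fixes g :: "real \<Rightarrow> 'a::euclidean_space"
  assumes "sq_int g"
  shows "sq_int (\<lambda>t. - g t)" and "L2norm (\<lambda>t. - g t) = L2norm g"
  using sq_int_scaleR[OF assms, of "-1"] by simp_all

lemma sq_int_diff:
  fixes g h :: "real \<Rightarrow> 'a::euclidean_space"
  assumes g: "sq_int g" and h: "sq_int h"
  shows "sq_int (\<lambda>t. g t - h t)" and "L2norm (\<lambda>t. g t - h t) \<le> L2norm g + L2norm h"
  using sq_int_add[OF g sq_int_uminus(1)[OF h]] sq_int_uminus(2)[OF h] by simp_all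

lemma sq_int_norm:
  fixes g :: "real \<Rightarrow> 'a::euclidean_space"
  assumes "sq_int g"
  shows "sq_int (\<lambda>t. norm (g t))" and "L2norm (\<lambda>t. norm (g t)) = L2norm g"
proof -
  have "(\<lambda>t. indicator {0..} t *\<^sub>R norm (g t)) = (\<lambda>t. norm (indicator {0..} t *\<^sub>R g t))"
    by (auto simp: indicator_def)
  moreover have "(\<lambda>t. norm (indicator {0..} t *\<^sub>R g t)) \<in> borel_measurable lborel"
    using sq_intD(1)[OF assms] by measurable
  ultimately show "sq_int (\<lambda>t. norm (g t))"
    using assms by (simp add: sq_int_def set_borel_measurable_def)
  show "L2norm (\<lambda>t. norm (g t)) = L2norm g"
    by (simp add: L2norm_def)
qed

section \<open>Square integrability from pointwise bounds and from pointwise limits\<close>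

lemma continuous_imp_set_borel_measurable:
  fixes g :: "real \<Rightarrow> 'a::euclidean_space"
  assumes "continuous_on {0..} g"
  shows "set_borel_measurable lborel {0..} g"
  using borel_measurable_continuous_on_indicator[OF _ assms]
  by (simp add: set_borel_measurable_def)

text \<open>Continuity supplies measurability, so a pointwise bound by two L2 functions does the
  rest. Later \<open>g\<close> is the residual, which is bounded in terms of the correction
  \<open>u\<close> and the reference trajectory \<open>v\<close>.\<close>

lemma sq_int_bound2:
  fixes g :: "real \<Rightarrow> 'a::euclidean_space" and u :: "real \<Rightarrow> 'b::euclidean_space"
    and v :: "real \<Rightarrow> 'c::euclidean_space"
  assumes g: "continuous_on {0..} g" and u: "sq_int u" and v: "sq_int v" and ab: "a \<ge> 0" "b \<ge> 0"
    and le: "\<And>t. t \<ge> 0 \<Longrightarrow> norm (g t) \<le> a * norm (u t) + b * norm (v t)"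
  shows "sq_int g" and "L2norm g \<le> a * L2norm u + b * L2norm v"
proof -
  let ?h = "\<lambda>t. a *\<^sub>R norm (u t) + b *\<^sub>R norm (v t)"
  note su = sq_int_scaleR[OF sq_int_norm(1)[OF u], of a]
    and sv = sq_int_scaleR[OF sq_int_norm(1)[OF v], of b]
  have h: "sq_int ?h" "L2norm ?h \<le> a * L2norm u + b * L2norm v"
    using sq_int_add[OF su(1) sv(1)] su(2) sv(2) sq_int_norm(2)[OF u] sq_int_norm(2)[OF v] ab
    by auto
  have "norm (g t) \<le> norm (?h t)" if "t \<ge> 0" for t
    using le[OF that] by (simp add: ab)
  from sq_int_mono[OF continuous_imp_set_borel_measurable[OF g] h(1) this]
  show "sq_int g" and "L2norm g \<le> a * L2norm u + b * L2norm v"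
    using h(2) by auto
qed

lemma sq_int_bound1:
  fixes g :: "real \<Rightarrow> 'a::euclidean_space" and u :: "real \<Rightarrow> 'b::euclidean_space"
  assumes g: "continuous_on {0..} g" and u: "sq_int u" and a: "a \<ge> 0"
    and le: "\<And>t. t \<ge> 0 \<Longrightarrow> norm (g t) \<le> a * norm (u t)"
  shows "sq_int g" and "L2norm g \<le> a * L2norm u"
  using sq_int_bound2[OF g u u a order_refl] le by auto

text \<open>Fatou's lemma applied to the squared norms. This is how the limit of the Picard iterates
  enters L2: pointwise convergence and a common bound stand in for completeness.\<close>

lemma sq_int_limit:
  fixes w :: "nat \<Rightarrow> real \<Rightarrow> 'a::euclidean_space"
  assumes w: "\<And>k. sq_int (w k)" and bound: "\<And>k. L2norm (w k) \<le> r"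
    and lim: "\<And>t. t \<ge> 0 \<Longrightarrow> (\<lambda>k. w k t) \<longlonglongrightarrow> v t"
  shows "sq_int v"
proof -
  let ?W = "\<lambda>k t. indicator {0..} t *\<^sub>R w k t" and ?V = "\<lambda>t. indicator {0..} t *\<^sub>R v t"
  have l: "(\<lambda>k. ?W k t) \<longlonglongrightarrow> ?V t" for t
    using lim[of t] by (cases "t \<ge> 0") auto
  have Wm: "?W k \<in> borel_measurable lborel" for k
    by (rule sq_intD(1)[OF w])
  have Vm: "?V \<in> borel_measurable lborel"
    by (rule borel_measurable_LIMSEQ_metric[OF Wm l])
  have ll: "(\<lambda>k. ennreal ((norm (?W k t))\<^sup>2)) \<longlonglongrightarrow> ennreal ((norm (?V t))\<^sup>2)" for t
    by (intro tendsto_ennrealI tendsto_power tendsto_norm l)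
  have "(\<integral>\<^sup>+t. ennreal ((norm (?V t))\<^sup>2) \<partial>lborel)
      = (\<integral>\<^sup>+t. liminf (\<lambda>k. ennreal ((norm (?W k t))\<^sup>2)) \<partial>lborel)"
    using lim_imp_Liminf[OF _ ll] by simp
  also have "\<dots> \<le> liminf (\<lambda>k. \<integral>\<^sup>+t. ennreal ((norm (?W k t))\<^sup>2) \<partial>lborel)"
    by (rule nn_integral_liminf) (use Wm in measurable)
  also have "\<dots> \<le> ennreal (r\<^sup>2)"
  proof (rule Liminf_le)
    have "(\<integral>\<^sup>+t. ennreal ((norm (?W k t))\<^sup>2) \<partial>lborel) \<le> ennreal (r\<^sup>2)" for k
    proof -
      have "(\<integral>\<^sup>+t. ennreal ((norm (?W k t))\<^sup>2) \<partial>lborel) = ennreal ((L2norm (w k))\<^sup>2)"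
        unfolding L2norm_sq by (rule nn_integral_eq_integral[OF sq_intD(2)[OF w]]) simp
      then show ?thesis using bound[of k] by (auto intro!: ennreal_leI power_mono)
    qed
    then show "\<forall>\<^sub>F k in sequentially. (\<integral>\<^sup>+t. ennreal ((norm (?W k t))\<^sup>2) \<partial>lborel) \<le> ennreal (r\<^sup>2)"
      by simp
  qed simp
  finally have fin: "(\<integral>\<^sup>+t. ennreal ((norm (?V t))\<^sup>2) \<partial>lborel) < \<infinity>"
    by (rule le_less_trans) simp
  have "integrable lborel (\<lambda>t. (norm (?V t))\<^sup>2)"
  proof (rule integrableI_nonneg)
    show "(\<lambda>t. (norm (?V t))\<^sup>2) \<in> borel_measurable lborel"
      using Vm by measurable
  qed (use fin in auto)
  moreover have e: "(\<lambda>t. indicator {0..} t *\<^sub>R (norm (v t))\<^sup>2) = (\<lambda>t. (norm (?V t))\<^sup>2)"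
    by (auto simp: indicator_def)
  ultimately show ?thesis
    unfolding sq_int_def set_borel_measurable_def set_integrable_def e using Vm by blast
qed

section \<open>Weak derivatives and the norm of W\<close>

text \<open>A pi-lambda argument: the half-lines are stable under intersection and generate the
  Borel sets, and the sets over which \<open>h\<close> integrates to zero are closed under
  complements and countable disjoint unions. An integrable function whose integral vanishes over
  every Borel set is zero almost everywhere.\<close>

lemma AE_eq_0_if_integral_atMost_eq_0:
  fixes h :: "real \<Rightarrow> 'a::euclidean_space"
  assumes i: "integrable lborel h" and z: "\<And>a. (LINT t:{..a}|lborel. h t) = 0"
  shows "AE t in lborel. h t = 0"
proof (rule sigma_finite_measure.density_zero)
  show "sigma_finite_measure (lborel :: real measure)"
    by (rule sigma_finite_lborel)
  show "integrable lborel h" by (rule i)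
  have si: "set_integrable lborel A h" if "A \<in> sets borel" for A
    using integrable_mult_indicator[OF _ i, of A] that by (simp add: set_integrable_def)
  \<comment> \<open>Closure under complements needs the integral over the whole line to vanish; it
    is the limit of the integrals over the half-lines up to \<open>n\<close>.\<close>
  have lim: "(\<lambda>n. LINT t:{..real n}|lborel. h t) \<longlonglongrightarrow> (LINT t|lborel. h t)"
    unfolding set_lebesgue_integral_def
  proof (rule integral_dominated_convergence[where w="\<lambda>t. norm (h t)"])
    show "AE t in lborel. (\<lambda>n. indicator {..real n} t *\<^sub>R h t) \<longlonglongrightarrow> h t"
    proof (rule AE_I2)
      fix t :: real
      have "\<forall>\<^sub>F n in sequentially. indicator {..real n} t *\<^sub>R h t = h t"
        using eventually_ge_at_top[of "nat \<lceil>t\<rceil>"]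
        by eventually_elim (auto simp: indicator_def)
      then show "(\<lambda>n. indicator {..real n} t *\<^sub>R h t) \<longlonglongrightarrow> h t"
        by (rule tendsto_eventually)
    qed
    show "AE t in lborel. norm (indicator {..real n} t *\<^sub>R h t) \<le> norm (h t)" for n
      by (auto simp: indicator_def)
  qed (use i in auto)
  have all: "(LINT t|lborel. h t) = 0"
    using lim unfolding z by (simp add: LIMSEQ_const_iff)
  have gen: "sets (borel :: real measure) = sigma_sets UNIV (range atMost)"
    by (simp add: borel_eq_atMost[where 'a=real] atMost_def)
  fix A :: "real set" assume "A \<in> sets lborel"
  then have A: "A \<in> sigma_sets UNIV (range atMost)" by (simp add: gen)
  have stable: "Int_stable (range atMost :: real set set)"
    by (auto simp: Int_stable_def)
  have sub: "range atMost \<subseteq> Pow (UNIV :: real set)" by simp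
  show "(LINT t:A|lborel. h t) = 0"
  proof (rule sigma_sets_induct_disjoint[OF stable sub A])
    fix A :: "real set" assume "A \<in> range atMost"
    then show "(LINT t:A|lborel. h t) = 0" using z by auto
  next
    show "(LINT t:{}|lborel. h t) = 0" by (simp add: set_lebesgue_integral_def)
  next
    fix A :: "real set" assume A: "A \<in> sigma_sets UNIV (range atMost)" and IH: "(LINT t:A|lborel. h t) = 0"
    then have Ab: "A \<in> sets borel" by (simp add: gen)
    have "(LINT t:A \<union> (UNIV - A)|lborel. h t) = (LINT t:A|lborel. h t) + (LINT t:UNIV - A|lborel. h t)"
      by (rule set_integral_Un) (use Ab in \<open>auto intro!: si\<close>)
    moreover have "A \<union> (UNIV - A) = UNIV" by auto
    ultimately show "(LINT t:UNIV - A|lborel. h t) = 0"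
      using IH all by (simp add: set_lebesgue_integral_def)
  next
    fix A :: "nat \<Rightarrow> real set"
    assume d: "disjoint_family A" and A: "range A \<subseteq> sigma_sets UNIV (range atMost)"
      and IH: "\<And>i. (LINT t:A i|lborel. h t) = 0"
    have Ab: "A i \<in> sets borel" for i using A by (auto simp: gen)
    have "(LINT t:(\<Union>i. A i)|lborel. h t) = (\<Sum>i. (LINT t:A i|lborel. h t))"
      using d Ab by (intro lebesgue_integral_countable_add si) (auto simp: disjoint_family_on_def)
    then show "(LINT t:(\<Union>i. A i)|lborel. h t) = 0" by (simp add: IH)
  qed
qed

text \<open>Here \<open>h\<close> is only locally integrable, so the half-line criterion is applied
  to its restrictions to \<open>{0..n}\<close>. Their integrals up to \<open>a\<close> are integrals
  of \<open>h\<close> up to \<open>min a n\<close>, or zero for negative \<open>a\<close>, and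
  countably many null sets are collected at the end.\<close>

lemma AE_eq_0_if_integral_eq_0:
  fixes h :: "real \<Rightarrow> 'a::euclidean_space"
  assumes i: "\<And>t. t \<ge> 0 \<Longrightarrow> set_integrable lborel {0..t} h"
    and z: "\<And>t. t \<ge> 0 \<Longrightarrow> (LINT s:{0..t}|lborel. h s) = 0"
  shows "AE t in lborel. t \<ge> 0 \<longrightarrow> h t = 0"
proof -
  have "AE t in lborel. indicator {0..real n} t *\<^sub>R h t = 0" for n
  proof (rule AE_eq_0_if_integral_atMost_eq_0)
    show "integrable lborel (\<lambda>t. indicator {0..real n} t *\<^sub>R h t)"
      using i[of "real n"] by (simp add: set_integrable_def)
    fix a :: real
    show "(LINT t:{..a}|lborel. indicator {0..real n} t *\<^sub>R h t) = 0"
    proof (cases "a \<ge> 0")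
      case True
      have "(\<lambda>t. indicator {..a} t *\<^sub>R (indicator {0..real n} t *\<^sub>R h t))
          = (\<lambda>t. indicator {0..min a (real n)} t *\<^sub>R h t)"
        by (auto simp: indicator_def)
      then show ?thesis
        using z[of "min a (real n)"] True by (simp add: set_lebesgue_integral_def)
    next
      case False
      then have "(\<lambda>t. indicator {..a} t *\<^sub>R (indicator {0..real n} t *\<^sub>R h t)) = (\<lambda>t. 0)"
        by (auto simp: indicator_def)
      then show ?thesis by (simp add: set_lebesgue_integral_def)
    qed
  qed
  then have "AE t in lborel. \<forall>n. indicator {0..real n} t *\<^sub>R h t = 0"
    by (subst AE_all_countable) blast
  then show ?thesis
  proof (rule AE_mp, intro AE_I2 impI)
    fix t :: real assume a: "\<forall>n. indicator {0..real n} t *\<^sub>R h t = 0" and "t \<ge> 0"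
    obtain n :: nat where "t \<le> real n" using real_arch_simple by blast
    with a[rule_format, of n] \<open>t \<ge> 0\<close> show "h t = 0" by (simp add: indicator_def)
  qed
qed

lemma is_wderivD:
  assumes "is_wderiv y g" "t \<ge> 0"
  shows "set_integrable lborel {0..t} g" and "y t = y 0 + (LINT s:{0..t}|lborel. g s)"
  using assms unfolding is_wderiv_def by blast+

lemma is_wderivI:
  assumes "\<And>t. t \<ge> 0 \<Longrightarrow> set_integrable lborel {0..t} g"
    and "\<And>t. t \<ge> 0 \<Longrightarrow> y t - y 0 = (LINT s:{0..t}|lborel. g s)"
  shows "is_wderiv y g"
  unfolding is_wderiv_def
proof (intro allI impI)
  fix t :: real assume t: "t \<ge> 0"
  from assms(2)[OF t] have "y t = y 0 + (LINT s:{0..t}|lborel. g s)"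
    by (simp add: algebra_simps)
  with assms(1)[OF t] show "set_integrable lborel {0..t} g \<and> y t = y 0 + (LINT s:{0..t}|lborel. g s)"
    by blast
qed

lemma is_wderiv_add:
  assumes g: "is_wderiv y g" and h: "is_wderiv z h"
  shows "is_wderiv (\<lambda>t. y t + z t) (\<lambda>t. g t + h t)"
proof (rule is_wderivI)
  fix t :: real assume t: "t \<ge> 0"
  note i = is_wderivD(1)[OF g t] is_wderivD(1)[OF h t]
  show "set_integrable lborel {0..t} (\<lambda>t. g t + h t)" using i by simp
  show "y t + z t - (y 0 + z 0) = (LINT s:{0..t}|lborel. g s + h s)"
    using i by (simp add: is_wderivD(2)[OF g t] is_wderivD(2)[OF h t])
qed

lemma is_wderiv_uminus:
  assumes g: "is_wderiv y g"
  shows "is_wderiv (\<lambda>t. - y t) (\<lambda>t. - g t)"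
proof (rule is_wderivI)
  fix t :: real assume t: "t \<ge> 0"
  note i = is_wderivD(1)[OF g t]
  show "set_integrable lborel {0..t} (\<lambda>t. - g t)" using i by (simp add: set_integrable_def)
  show "- y t - (- y 0) = (LINT s:{0..t}|lborel. - g s)"
    by (simp add: set_integral_uminus[OF i] is_wderivD(2)[OF g t])
qed

lemma is_wderiv_diff:
  assumes "is_wderiv y g" "is_wderiv z h"
  shows "is_wderiv (y - z) (\<lambda>t. g t - h t)"
proof -
  have "y - z = (\<lambda>t. y t + - z t)" by auto
  then show ?thesis
    using is_wderiv_add[OF assms(1) is_wderiv_uminus[OF assms(2)]] by simp
qed

lemma is_wderiv_cong:
  assumes g: "is_wderiv y g" and eq: "\<And>t. t \<ge> 0 \<Longrightarrow> g t = h t"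
  shows "is_wderiv y h"
proof (rule is_wderivI)
  fix t :: real assume t: "t \<ge> 0"
  have "set_integrable lborel {0..t} g \<longleftrightarrow> set_integrable lborel {0..t} h"
    by (rule set_integrable_cong) (use eq in auto)
  then show "set_integrable lborel {0..t} h"
    using is_wderivD(1)[OF g t] by blast
  have "(LINT s:{0..t}|lborel. g s) = (LINT s:{0..t}|lborel. h s)"
    by (rule set_lebesgue_integral_cong) (use eq in auto)
  then show "y t - y 0 = (LINT s:{0..t}|lborel. h s)"
    by (simp add: is_wderivD(2)[OF g t])
qed

lemma wderiv_AE_unique:
  assumes g: "is_wderiv y g" and h: "is_wderiv y h"
  shows "AE t in lborel. t \<ge> 0 \<longrightarrow> g t = h t"
proof -
  have "AE t in lborel. t \<ge> 0 \<longrightarrow> g t - h t = 0"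
  proof (rule AE_eq_0_if_integral_eq_0)
    fix t :: real assume t: "t \<ge> 0"
    note i = is_wderivD(1)[OF g t] is_wderivD(1)[OF h t]
    show "set_integrable lborel {0..t} (\<lambda>t. g t - h t)"
      using i by simp
    show "(LINT s:{0..t}|lborel. g s - h s) = 0"
      using i is_wderivD(2)[OF g t] is_wderivD(2)[OF h t] by simp
  qed
  then show ?thesis by simp
qed

section \<open>The norm of W and its triangle inequality\<close>

lemma L2norm_cong_AE:
  assumes "sq_int g" "sq_int h" and ae: "AE t in lborel. t \<ge> 0 \<longrightarrow> g t = h t"
  shows "L2norm g = L2norm h"
proof -
  have "(L2norm g)\<^sup>2 = (L2norm h)\<^sup>2"
    unfolding L2norm_sq
  proof (rule integral_cong_AE)
    show "AE t in lborel. (norm (indicator {0..} t *\<^sub>R g t))\<^sup>2 = (norm (indicator {0..} t *\<^sub>R h t))\<^sup>2"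
      using ae by eventually_elim (auto simp: indicator_def)
  qed (use sq_intD(2)[OF assms(1)] sq_intD(2)[OF assms(2)] in \<open>auto intro: borel_measurable_integrable\<close>)
  then show ?thesis by (simp add: power2_eq_iff_nonneg)
qed

text \<open>Since \<open>wderiv\<close> is an arbitrary choice, \<open>Wnorm\<close> could not be
  computed from its definition alone. Almost everywhere uniqueness removes the choice: any square
  integrable weak derivative at hand yields the same norm.\<close>

lemma Wnorm_eq:
  assumes g: "is_wderiv y g" "sq_int g"
  shows "Wnorm y = sqrt ((L2norm y)\<^sup>2 + (L2norm g)\<^sup>2)"
proof -
  have w: "is_wderiv y (wderiv y)" "sq_int (wderiv y)"
    using someI[of "\<lambda>g. is_wderiv y g \<and> sq_int g" g] g by (auto simp: wderiv_def)
  have "L2norm (wderiv y) = L2norm g"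
    by (rule L2norm_cong_AE[OF w(2) g(2) wderiv_AE_unique[OF w(1) g(1)]])
  then show ?thesis by (simp add: Wnorm_def)
qed

text \<open>Minkowski for the function and for its derivative, followed by the triangle inequality
  in the plane.\<close>

lemma Winf_diff:
  fixes y z :: "real \<Rightarrow> 'a::euclidean_space"
  assumes "Winf y" "Winf z"
  shows "Winf (y - z)" and "Wnorm (y - z) \<le> Wnorm y + Wnorm z"
proof -
  obtain g where g: "sq_int y" "is_wderiv y g" "sq_int g"
    using assms(1) unfolding Winf_def by blast
  obtain h where h: "sq_int z" "is_wderiv z h" "sq_int h"
    using assms(2) unfolding Winf_def by blast
  have eq: "y - z = (\<lambda>t. y t - z t)" by auto
  note s = sq_int_diff[OF g(1) h(1)] and d = sq_int_diff[OF g(3) h(3)]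
    and w = is_wderiv_diff[OF g(2) h(2)]
  show "Winf (y - z)"
    using s(1) d(1) w unfolding Winf_def eq by blast
  have "Wnorm (y - z) = sqrt ((L2norm (y - z))\<^sup>2 + (L2norm (\<lambda>t. g t - h t))\<^sup>2)"
    by (rule Wnorm_eq[OF w d(1)])
  also have "\<dots> \<le> sqrt ((L2norm y + L2norm z)\<^sup>2 + (L2norm g + L2norm h)\<^sup>2)"
    using s(2) d(2) unfolding eq by (intro real_sqrt_le_mono add_mono power_mono) auto
  also have "\<dots> \<le> sqrt ((L2norm y)\<^sup>2 + (L2norm g)\<^sup>2) + sqrt ((L2norm z)\<^sup>2 + (L2norm h)\<^sup>2)"
    by (rule real_sqrt_sum_squares_triangle_ineq)
  also have "\<dots> = Wnorm y + Wnorm z"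
    using Wnorm_eq[OF g(2,3)] Wnorm_eq[OF h(2,3)] by simp
  finally show "Wnorm (y - z) \<le> Wnorm y + Wnorm z" .
qed

lemma Winf_uminus:
  fixes y :: "real \<Rightarrow> 'a::euclidean_space"
  assumes "Winf y"
  shows "Winf (\<lambda>t. - y t)" and "Wnorm (\<lambda>t. - y t) = Wnorm y"
proof -
  obtain g where g: "sq_int y" "is_wderiv y g" "sq_int g"
    using assms unfolding Winf_def by blast
  note s = sq_int_uminus[OF g(1)] and d = sq_int_uminus[OF g(3)] and w = is_wderiv_uminus[OF g(2)]
  show "Winf (\<lambda>t. - y t)"
    using s(1) d(1) w unfolding Winf_def by blast
  show "Wnorm (\<lambda>t. - y t) = Wnorm y"
    using Wnorm_eq[OF w d(1)] Wnorm_eq[OF g(2,3)] s(2) d(2) by simp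
qed

lemma Winf_add:
  fixes y z :: "real \<Rightarrow> 'a::euclidean_space"
  assumes "Winf y" "Winf z"
  shows "Winf (\<lambda>t. y t + z t)" and "Wnorm (\<lambda>t. y t + z t) \<le> Wnorm y + Wnorm z"
proof -
  have eq: "(\<lambda>t. y t + z t) = y - (\<lambda>t. - z t)" by auto
  show "Winf (\<lambda>t. y t + z t)" "Wnorm (\<lambda>t. y t + z t) \<le> Wnorm y + Wnorm z"
    using Winf_diff[OF assms(1) Winf_uminus(1)[OF assms(2)]] Winf_uminus(2)[OF assms(2)]
    unfolding eq by auto
qed

lemma Wnorm_minus_commute:
  fixes y z :: "real \<Rightarrow> 'a::euclidean_space"
  assumes "Winf y" "Winf z"
  shows "Wnorm (y - z) = Wnorm (z - y)"
proof -
  have "(\<lambda>t. - (z - y) t) = y - z" by auto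
  then show ?thesis using Winf_uminus(2)[OF Winf_diff(1)[OF assms(2,1)]] by simp
qed

lemma abs_Wnorm_diff_le:
  fixes y z :: "real \<Rightarrow> 'a::euclidean_space"
  assumes y: "Winf y" and z: "Winf z"
  shows "\<bar>Wnorm y - Wnorm z\<bar> \<le> Wnorm (y - z)"
proof -
  have "Wnorm y \<le> Wnorm (y - z) + Wnorm z" "Wnorm z \<le> Wnorm (z - y) + Wnorm y"
    using Winf_add(2)[OF Winf_diff(1)[OF y z] z] Winf_add(2)[OF Winf_diff(1)[OF z y] y] by simp_all
  then show ?thesis using Wnorm_minus_commute[OF y z] by simp
qed

section \<open>Continuity of weakly differentiable functions and Gronwall's lemma\<close>

lemma is_wderivD_integral:
  fixes y :: "real \<Rightarrow> 'a::euclidean_space"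
  assumes "is_wderiv y g" "t \<ge> 0"
  shows "g integrable_on {0..t}" and "y t = y 0 + integral {0..t} g"
proof -
  note e = set_borel_integral_eq_integral[OF is_wderivD(1)[OF assms]]
  show "g integrable_on {0..t}" by (rule e(1))
  show "y t = y 0 + integral {0..t} g" using is_wderivD(2)[OF assms] unfolding e(2) .
qed

lemma is_wderiv_continuous_on:
  fixes y :: "real \<Rightarrow> 'a::euclidean_space"
  assumes "is_wderiv y g"
  shows "continuous_on {0..} y"
proof -
  note gi = is_wderivD_integral(1)[OF assms] and y = is_wderivD_integral(2)[OF assms]
  have c: "continuous_on {0..T} y" if "T \<ge> 0" for T
  proof -
    have "continuous_on {0..T} (\<lambda>t. y 0 + integral {0..t} g)"
      by (intro continuous_intros indefinite_integral_continuous_1 gi that)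
    then show ?thesis
      by (rule continuous_on_eq) (use y in \<open>metis atLeastAtMost_iff\<close>)
  qed
  show ?thesis
    unfolding continuous_on_eq_continuous_within
  proof
    fix t :: real assume t: "t \<in> {0..}"
    then have "continuous (at t within {0..t+1}) y"
      using c[of "t+1"] by (auto simp: continuous_on_eq_continuous_within)
    \<comment> \<open>Continuity is local, and \<open>{0..t+1}\<close> is a neighbourhood of
      \<open>t\<close> relative to the half line.\<close>
    moreover have "at t within {0..t+1} = at t within {0..}"
      by (rule at_within_nhd[of _ "{..<t+1}"]) (use t in auto)
    ultimately show "continuous (at t within {0..}) y"
      by (simp add: continuous_within)
  qed
qed

lemma Winf_continuous:
  fixes y :: "real \<Rightarrow> 'a::euclidean_space"
  shows "Winf y \<Longrightarrow> continuous_on {0..} y"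
  unfolding Winf_def using is_wderiv_continuous_on by blast

text \<open>With \<open>g\<close> the integral of \<open>norm d\<close>, the product
  \<open>exp (- L * t) * g t\<close> has derivative
  \<open>exp (- L * t) * (norm (d t) - L * g t)\<close>, which the hypothesis makes nonpositive. As
  it starts at zero, \<open>g\<close> is never positive, and the hypothesis then forces
  \<open>d\<close> to vanish.\<close>

lemma Gronwall_zero:
  fixes d :: "real \<Rightarrow> 'a::euclidean_space"
  assumes c: "continuous_on {0..} d" and L: "L \<ge> 0"
    and le: "\<And>t. t \<ge> 0 \<Longrightarrow> norm (d t) \<le> L * integral {0..t} (\<lambda>s. norm (d s))"
    and T: "T \<ge> 0"
  shows "d T = 0"
proof -
  define g where "g t = integral {0..t} (\<lambda>s. norm (d s))" for t
  have cn: "continuous_on {0..T} (\<lambda>s. norm (d s))"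
    by (intro continuous_on_norm continuous_on_subset[OF c]) auto
  have g': "(g has_real_derivative norm (d t)) (at t within {0..T})" if "t \<in> {0..T}" for t
    unfolding g_def has_real_derivative_iff_has_vector_derivative
    using integral_has_vector_derivative[OF cn that] .
  have gc: "continuous_on {0..T} g"
    by (rule DERIV_continuous_on[OF g'])
  have "exp (- L * T) * g T \<le> exp (- L * 0) * g 0"
  proof (rule DERIV_nonpos_imp_decreasing_open[OF T])
    show "continuous_on {0..T} (\<lambda>t. exp (- L * t) * g t)"
      by (intro continuous_intros gc)
    fix t assume t: "0 < t" "t < T"
    have "(g has_real_derivative norm (d t)) (at t)"
      using g'[of t] t at_within_Icc_at[of 0 t T] by simp
    then have "((\<lambda>t. exp (- L * t) * g t) has_real_derivative exp (- L * t) * (norm (d t) - L * g t)) (at t)"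
      by (auto intro!: derivative_eq_intros simp: algebra_simps)
    moreover have "exp (- L * t) * (norm (d t) - L * g t) \<le> 0"
      using le[of t] t by (intro mult_nonneg_nonpos) (auto simp: g_def)
    ultimately show "\<exists>y. ((\<lambda>t. exp (- L * t) * g t) has_real_derivative y) (at t) \<and> y \<le> 0"
      by blast
  qed
  then have "g T \<le> 0"
    by (simp add: g_def mult_le_0_iff)
  then have "norm (d T) \<le> 0"
    using le[OF T] mult_nonneg_nonpos[OF L, of "g T"] unfolding g_def by linarith
  then show ?thesis by simp
qed

section \<open>Linearization, networks and strong measurability\<close>

text \<open>The mean value inequality for \<open>H - DH c\<close>, whose derivative
  \<open>DH x - DH c\<close> has norm at most \<open>L * r\<close> within distance \<open>r\<close>
  of \<open>c\<close>. The base point \<open>c\<close> is kept apart from \<open>a\<close> and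
  \<open>b\<close> because two perturbed states are later compared through the linearization at a
  third, the reference state.\<close>

lemma linearization_error_le:
  fixes H :: "'a::real_normed_vector \<Rightarrow> 'b::real_normed_vector"
  assumes K: "convex K"
    and der: "\<And>x. x \<in> K \<Longrightarrow> (H has_derivative DH x) (at x within K)"
    and lip: "\<And>x z. x \<in> K \<Longrightarrow> z \<in> K \<Longrightarrow> onorm (\<lambda>h. DH x h - DH z h) \<le> L * norm (x - z)"
    and L: "L \<ge> 0"
    and abc: "a \<in> K" "b \<in> K" "c \<in> K" and r: "norm (a - c) \<le> r" "norm (b - c) \<le> r"
  shows "norm (H a - H b - DH c (a - b)) \<le> L * r * norm (a - b)"
proof -
  let ?S = "K \<inter> cball c r"
  have bl: "bounded_linear (DH c)"
    using der[OF abc(3)] by (rule has_derivative_bounded_linear)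
  have "norm ((H a - DH c a) - (H b - DH c b)) \<le> (L * r) * norm (a - b)"
  proof (rule differentiable_bound)
    show "convex ?S" using K by (intro convex_Int convex_cball)
    show "((\<lambda>x. H x - DH c x) has_derivative (\<lambda>h. DH x h - DH c h)) (at x within ?S)" if "x \<in> ?S" for x
      using that der[of x]
      by (auto intro!: has_derivative_diff bounded_linear_imp_has_derivative bl
          intro!: has_derivative_subset[OF der])
    show "onorm (\<lambda>h. DH x h - DH c h) \<le> L * r" if x: "x \<in> ?S" for x
    proof -
      have "norm (x - c) \<le> r" using x by (simp add: dist_norm norm_minus_commute)
      then have "L * norm (x - c) \<le> L * r" using L by (rule mult_left_mono)
      with lip[of x c] x abc(3) show ?thesis by force
    qed
    show "a \<in> ?S" "b \<in> ?S" using abc r by (auto simp: dist_norm norm_minus_commute)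
  qed
  then show ?thesis
    by (simp add: linear_diff[OF bounded_linear.linear[OF bl]] algebra_simps)
qed

text \<open>Expanding \<open>w t\<close> in the standard basis reduces the claim to continuity of
  \<open>x \<mapsto> DH x e\<close> for a fixed vector \<open>e\<close>, which is Lipschitz by the
  operator norm estimate.\<close>

lemma continuous_on_derivative_apply:
  fixes DH :: "'a::euclidean_space \<Rightarrow> 'a \<Rightarrow> 'b::euclidean_space"
  assumes bl: "\<And>x. x \<in> K \<Longrightarrow> bounded_linear (DH x)"
    and lip: "\<And>x z. x \<in> K \<Longrightarrow> z \<in> K \<Longrightarrow> onorm (\<lambda>h. DH x h - DH z h) \<le> L * norm (x - z)"
    and L: "L \<ge> 0"
    and y: "continuous_on I y" "\<And>t. t \<in> I \<Longrightarrow> y t \<in> K" and w: "continuous_on I w"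
  shows "continuous_on I (\<lambda>t. DH (y t) (w t))"
proof -
  have c: "continuous_on K (\<lambda>x. DH x e)" for e
  proof (rule lipschitz_on_continuous_on)
    show "(L * norm e)-lipschitz_on K (\<lambda>x. DH x e)"
    proof (rule lipschitz_onI)
      fix x z assume xz: "x \<in> K" "z \<in> K"
      have "norm (DH x e - DH z e) \<le> onorm (\<lambda>h. DH x h - DH z h) * norm e"
        using onorm[OF bounded_linear_sub[OF bl bl], OF xz, of e] by simp
      also have "\<dots> \<le> L * norm (x - z) * norm e"
        using lip[OF xz] by (rule mult_right_mono) simp
      finally show "dist (DH x e) (DH z e) \<le> L * norm e * dist x z"
        by (simp add: dist_norm mult_ac)
    qed (use L in simp)
  qed
  have "continuous_on I (\<lambda>t. \<Sum>e\<in>Basis. (w t \<bullet> e) *\<^sub>R DH (y t) e)"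
    by (intro continuous_intros w continuous_on_compose2[OF c y(1)]) (use y(2) in auto)
  moreover have "(\<Sum>e\<in>Basis. (w t \<bullet> e) *\<^sub>R DH (y t) e) = DH (y t) (w t)" if "t \<in> I" for t
  proof -
    have lin: "linear (DH (y t))" using bl y(2)[OF that] bounded_linear.linear by blast
    have "DH (y t) (w t) = DH (y t) (\<Sum>e\<in>Basis. (w t \<bullet> e) *\<^sub>R e)"
      by (simp only: euclidean_representation)
    also have "\<dots> = (\<Sum>e\<in>Basis. (w t \<bullet> e) *\<^sub>R DH (y t) e)"
      by (simp add: linear_sum[OF lin] linear_cmul[OF lin])
    finally show ?thesis by simp
  qed
  ultimately show ?thesis
    by (rule continuous_on_eq)
qed

section \<open>Differentiability of networks\<close>

text \<open>The input \<open>h\<close> is an arbitrary differentiable function of \<open>x\<close>,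
  so that the output of a hidden layer can serve as the input of the remaining layers in the
  induction. The case split on \<open>rest\<close> separates the affine last layer from the layers
  that apply \<open>\<sigma>\<close>.\<close>

lemma eval_layers_differentiable:
  fixes h :: "'a::real_normed_vector \<Rightarrow> nat \<Rightarrow> real"
  assumes \<sigma>: "\<And>s. \<sigma> differentiable (at s)" and "\<And>j. (\<lambda>x. h x j) differentiable (at x)"
  shows "(\<lambda>x. eval_layers \<sigma> Np \<theta> (h x) i) differentiable (at x)"
  using assms(2)
proof (induction \<theta> arbitrary: h Np i)
  case Nil
  then show ?case by simp
next
  case (Cons l rest)
  note IH = Cons.IH
  obtain N W b where l: "l = (N, W, b)" by (cases l)
  have aff: "(\<lambda>x. (\<Sum>j<Np. W i j * h x j) + b i) differentiable (at x)" for i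
    by (intro differentiable_add differentiable_sum differentiable_mult differentiable_const Cons.prems ballI) simp
  show ?case
  proof (cases rest)
    case Nil
    then show ?thesis using aff by (simp add: l)
  next
    case (Cons l' rest')
    have "(\<lambda>x. \<sigma> ((\<Sum>j<Np. W i j * h x j) + b i)) differentiable (at x)" for i
      using differentiable_chain_at[OF aff \<sigma>] by (simp add: o_def)
    then have "(\<lambda>x. eval_layers \<sigma> N rest (\<lambda>i. \<sigma> ((\<Sum>j<Np. W i j * h x j) + b i)) i) differentiable (at x)"
      by (rule IH)
    then show ?thesis
      by (simp add: l Cons)
  qed
qed

lemma Fnet_differentiable:
  assumes "\<sigma> C1_differentiable_on UNIV"
  shows "(Fnet \<sigma> \<theta> :: 'a::euclidean_space \<Rightarrow> 'b::euclidean_space) differentiable (at x)"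
proof -
  have \<sigma>: "\<sigma> differentiable (at s)" for s
    using assms by (auto simp: C1_differentiable_on_eq)
  have "(\<lambda>x::'a. x \<bullet> basis_enum j) differentiable (at x)" for j
    by (intro bounded_linear_imp_differentiable bounded_linear_inner_left)
  note e = eval_layers_differentiable[OF \<sigma> this]
  have "(Psi \<sigma> \<theta> :: 'a \<Rightarrow> 'b) differentiable (at x)"
    unfolding Psi_def[abs_def]
    by (intro differentiable_sum differentiable_scaleR differentiable_const e ballI) simp
  then show ?thesis
    unfolding Fnet_def[abs_def] by (intro differentiable_diff differentiable_const)
qed

section \<open>Strong measurability and essential bounds of continuous families\<close>

text \<open>Compactness covers \<open>S\<close> by finitely many balls on each of which
  \<open>Y\<close> stays within \<open>e\<close> of its value at the centre. Sending every point to
  the value at the centre of the first ball containing it gives a simple function uniformly within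
  \<open>e\<close> of \<open>Y\<close>.\<close>

lemma strongly_measurable_W_continuous:
  fixes Y :: "'x::metric_space \<Rightarrow> real \<Rightarrow> 'a::euclidean_space"
  assumes S: "compact S" "space \<mu> = S" and borel: "sets (restrict_space borel S) \<subseteq> sets \<mu>"
    and W: "\<And>x. x \<in> S \<Longrightarrow> Winf (Y x)"
    and cont: "\<And>x e. x \<in> S \<Longrightarrow> e > 0 \<Longrightarrow> \<exists>d>0. \<forall>z\<in>S. dist x z < d \<longrightarrow> Wnorm (Y x - Y z) < e"
  shows "strongly_measurable_W \<mu> Y"
proof -
  have "\<exists>s. finite (s ` S) \<and> (\<forall>x\<in>S. Winf (s x)) \<and> (\<forall>v. {x \<in> S. s x = v} \<in> sets \<mu>) \<and>
      (\<forall>x\<in>S. Wnorm (s x - Y x) < e)" if e: "e > 0" for e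
  proof -
    obtain d where d: "\<And>x. x \<in> S \<Longrightarrow> d x > 0"
      "\<And>x z. x \<in> S \<Longrightarrow> z \<in> S \<Longrightarrow> dist x z < d x \<Longrightarrow> Wnorm (Y x - Y z) < e"
      using cont[OF _ e] by metis
    obtain C where C: "C \<subseteq> S" "finite C" "S \<subseteq> (\<Union>x\<in>C. ball x (d x))"
      by (rule compactE_image[OF S(1), of S "\<lambda>x. ball x (d x)"]) (use d(1) in force)+
    \<comment> \<open>Listing the centres orders them, so that "the first ball containing z" makes
      sense and the level sets are disjoint.\<close>
    obtain xs where xs: "set xs = C" using finite_list[OF C(2)] by blast
    define c where "c z = (LEAST i. i < length xs \<and> z \<in> ball (xs ! i) (d (xs ! i)))" for z
    have c: "c z < length xs \<and> z \<in> ball (xs ! c z) (d (xs ! c z))" if zS: "z \<in> S" for z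
    proof -
      obtain x where "x \<in> C" "z \<in> ball x (d x)" using C(3) zS by blast
      then obtain i where "i < length xs \<and> z \<in> ball (xs ! i) (d (xs ! i))"
        using xs by (metis in_set_conv_nth)
      then show ?thesis unfolding c_def by (rule LeastI)
    qed
    have cS: "xs ! c z \<in> S" if "z \<in> S" for z
    proof -
      have "xs ! c z \<in> set xs" using c[OF that] by (intro nth_mem) simp
      then show ?thesis using xs C(1) by blast
    qed
    have m: "{z \<in> S. c z = i} \<in> sets \<mu>" for i
    proof (cases "i < length xs")
      case True
      \<comment> \<open>A point gets index \<open>i\<close> exactly when it lies in ball
        \<open>i\<close> and in no earlier ball: a Borel condition relative to
        \<open>S\<close>.\<close>
      let ?U = "ball (xs ! i) (d (xs ! i)) - (\<Union>j<i. ball (xs ! j) (d (xs ! j)))"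
      have "{z \<in> S. c z = i} = ?U \<inter> S"
      proof (intro equalityI subsetI)
        fix z assume z: "z \<in> {z \<in> S. c z = i}"
        have "z \<notin> ball (xs ! j) (d (xs ! j))" if "j < i" for j
          using not_less_Least[of j "\<lambda>i. i < length xs \<and> z \<in> ball (xs ! i) (d (xs ! i))"] that z True
          unfolding c_def by auto
        with z c[of z] show "z \<in> ?U \<inter> S" by auto
      next
        fix z assume z: "z \<in> ?U \<inter> S"
        have "c z = i"
          unfolding c_def
        proof (rule Least_equality)
          fix j assume "j < length xs \<and> z \<in> ball (xs ! j) (d (xs ! j))"
          then show "i \<le> j" using z by (meson DiffD2 IntD1 UN_I lessThan_iff not_le)
        qed (use z True in auto)
        with z show "z \<in> {z \<in> S. c z = i}" by auto
      qed
      moreover have "?U \<in> sets borel"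
        by (intro sets.Diff borel_open open_UN ballI open_ball)
      ultimately have "{z \<in> S. c z = i} \<in> sets (restrict_space borel S)"
        unfolding sets_restrict_space by (intro image_eqI[of _ _ ?U]) (simp_all add: Int_commute)
      then show ?thesis using borel by blast
    next
      case False
      then have "{z \<in> S. c z = i} = {}" using c by auto
      then show ?thesis by (simp only: sets.empty_sets)
    qed
    define s where "s z = Y (xs ! c z)" for z
    have "s ` S \<subseteq> Y ` C" using c xs by (auto simp: s_def)
    then have "finite (s ` S)" using C(2) finite_subset by blast
    moreover have "{x \<in> S. s x = v} \<in> sets \<mu>" for v
    proof -
      \<comment> \<open>Several centres may share the same value of \<open>Y\<close>, so a level set
        of \<open>s\<close> is a finite union of index sets.\<close>
      have "{x \<in> S. s x = v} = (\<Union>i\<in>{i. i < length xs \<and> Y (xs ! i) = v}. {z \<in> S. c z = i})"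
        using c by (auto simp: s_def)
      also have "\<dots> \<in> sets \<mu>" by (intro sets.finite_UN m) auto
      finally show ?thesis .
    qed
    moreover have "Wnorm (s x - Y x) < e" if "x \<in> S" for x
      unfolding s_def by (rule d(2)) (use cS c that in auto)
    moreover have "Winf (s x)" if "x \<in> S" for x
      unfolding s_def by (rule W[OF cS[OF that]])
    ultimately show ?thesis by blast
  qed
  then have "\<forall>k. \<exists>s. finite (s ` S) \<and> (\<forall>x\<in>S. Winf (s x)) \<and> (\<forall>v. {x \<in> S. s x = v} \<in> sets \<mu>) \<and>
      (\<forall>x\<in>S. Wnorm (s x - Y x) < inverse (real (Suc k)))"
    by simp
  from choice[OF this] obtain s :: "nat \<Rightarrow> 'x \<Rightarrow> real \<Rightarrow> 'a"
    where "\<forall>k. finite (s k ` S) \<and> (\<forall>x\<in>S. Winf (s k x)) \<and> (\<forall>v. {x \<in> S. s k x = v} \<in> sets \<mu>) \<and>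
      (\<forall>x\<in>S. Wnorm (s k x - Y x) < inverse (real (Suc k)))" ..
  then have s: "\<forall>k. finite (s k ` S) \<and> (\<forall>x\<in>S. Winf (s k x)) \<and> (\<forall>v. {x \<in> S. s k x = v} \<in> sets \<mu>)"
    and s_lim: "\<And>k x. x \<in> S \<Longrightarrow> Wnorm (s k x - Y x) < inverse (real (Suc k))"
    by blast+
  have "(\<lambda>k. Wnorm (s k x - Y x)) \<longlonglongrightarrow> 0" if "x \<in> S" for x
    by (rule tendsto_sandwich[OF _ _ tendsto_const LIMSEQ_inverse_real_of_nat])
      (use s_lim[OF that] in \<open>auto intro!: always_eventually less_imp_le\<close>)
  then have "AE x in \<mu>. (\<lambda>k. Wnorm (s k x - Y x)) \<longlonglongrightarrow> 0"
    by (intro AE_I2) (simp add: S(2))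
  then show ?thesis
    unfolding strongly_measurable_W_def S(2) using W s by blast
qed

text \<open>The essential supremum is bounded by a pointwise bound once the norm is measurable. The
  reverse triangle inequality makes it continuous on \<open>S\<close>, hence measurable for the
  trace Borel sets and so for \<open>\<mu>\<close>.\<close>

lemma Linf_W_norm_continuous_le:
  fixes Y :: "'x::metric_space \<Rightarrow> real \<Rightarrow> 'a::euclidean_space"
  assumes S: "space \<mu> = S" and borel: "sets (restrict_space borel S) \<subseteq> sets \<mu>"
    and W: "\<And>x. x \<in> S \<Longrightarrow> Winf (Y x)"
    and cont: "\<And>x e. x \<in> S \<Longrightarrow> e > 0 \<Longrightarrow> \<exists>d>0. \<forall>z\<in>S. dist x z < d \<longrightarrow> Wnorm (Y x - Y z) < e"
    and le: "\<And>x. x \<in> S \<Longrightarrow> Wnorm (Y x) \<le> r"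
  shows "Linf_W_norm \<mu> Y \<le> ereal r"
proof -
  have "continuous_on S (\<lambda>x. Wnorm (Y x))"
    unfolding continuous_on_iff
  proof (intro ballI allI impI)
    fix x and e :: real assume x: "x \<in> S" and "e > 0"
    from cont[OF this] obtain d where d: "d > 0" "\<And>z. z \<in> S \<Longrightarrow> dist x z < d \<Longrightarrow> Wnorm (Y x - Y z) < e"
      by blast
    have "dist (Wnorm (Y z)) (Wnorm (Y x)) < e" if z: "z \<in> S" "dist z x < d" for z
      using abs_Wnorm_diff_le[OF W[OF x] W[OF z(1)]] d(2)[OF z(1)] z(2)
      by (simp add: dist_real_def dist_commute abs_minus_commute)
    with d(1) show "\<exists>d>0. \<forall>z\<in>S. dist z x < d \<longrightarrow> dist (Wnorm (Y z)) (Wnorm (Y x)) < e"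
      by blast
  qed
  then have "(\<lambda>x. Wnorm (Y x)) \<in> borel_measurable (restrict_space borel S)"
    by (rule borel_measurable_continuous_on_restrict)
  then have "(\<lambda>x. Wnorm (Y x)) \<in> borel_measurable \<mu>"
    using borel S by (auto simp: measurable_def space_restrict_space)
  then have "(\<lambda>x. ereal (Wnorm (Y x))) \<in> borel_measurable \<mu>"
    by measurable
  then show ?thesis
    unfolding Linf_W_norm_def by (rule esssup_I) (auto intro!: AE_I2 simp: S le)
qed

section \<open>Perturbation of a stable trajectory\<close>

text \<open>\<open>ys\<close> is a trajectory of \<open>H\<close> whose linearization is uniformly stable with constant \<open>C\<close>;
  \<open>G\<close> differs from \<open>H\<close> by a map of Lipschitz constant \<open>\<eta>\<close> vanishing at the origin.\<close>

locale perturbed_trajectory =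
  fixes H G :: "'a::euclidean_space \<Rightarrow> 'a" and DH :: "'a \<Rightarrow> 'a \<Rightarrow> 'a"
    and r L \<eta> C Ci :: real and ys :: "real \<Rightarrow> 'a"
  assumes H_deriv: "\<And>x. x \<in> cball 0 r \<Longrightarrow> (H has_derivative DH x) (at x within cball 0 r)"
    and DH_lip: "\<And>x z. x \<in> cball 0 r \<Longrightarrow> z \<in> cball 0 r \<Longrightarrow>
      onorm (\<lambda>h. DH x h - DH z h) \<le> L * norm (x - z)"
    and L_nonneg: "L \<ge> 0" and \<eta>_nonneg: "\<eta> \<ge> 0" and C_pos: "C > 0" and Ci_pos: "Ci > 0"
    and G_diff: "\<And>a b. a \<in> cball 0 r \<Longrightarrow> b \<in> cball 0 r \<Longrightarrow>
      norm ((G a - H a) - (G b - H b)) \<le> \<eta> * norm (a - b)"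
    and G_0: "G 0 = H 0"
    and emb: "\<And>y t. Winf (y :: real \<Rightarrow> 'a) \<Longrightarrow> t \<ge> 0 \<Longrightarrow> norm (y t) \<le> Ci * Wnorm y"
    and ys_W: "Winf ys" and ys_deriv: "is_wderiv ys (\<lambda>t. H (ys t))"
    and ys_in: "\<And>t. t \<ge> 0 \<Longrightarrow> norm (ys t) \<le> r"
    and lin_ex: "\<And>dv. sq_int dv \<Longrightarrow>
      \<exists>dy. Winf dy \<and> dy 0 = 0 \<and> is_wderiv dy (\<lambda>t. DH (ys t) (dy t) + dv t)"
    and lin_bound: "\<And>dv dy. sq_int dv \<Longrightarrow> Winf dy \<Longrightarrow> is_wderiv dy (\<lambda>t. DH (ys t) (dy t) + dv t) \<Longrightarrow>
      Wnorm dy \<le> C * (L2norm dv + norm (dy 0))"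
begin

section \<open>Bounds for the perturbed field on the ball\<close>

lemma r_nonneg: "r \<ge> 0"
  using ys_in[of 0] norm_ge_zero[of "ys 0"] by linarith

lemma DH_bl: "norm x \<le> r \<Longrightarrow> bounded_linear (DH x)"
  using H_deriv[of x] by (auto intro: has_derivative_bounded_linear)

lemma DH_bounded: "\<exists>A\<ge>0. \<forall>x. norm x \<le> r \<longrightarrow> onorm (DH x) \<le> A"
proof (intro exI conjI allI impI)
  show "0 \<le> L * r + onorm (DH 0)"
    using L_nonneg r_nonneg onorm_pos_le[OF DH_bl, of 0] by simp
  fix x :: 'a assume x: "norm x \<le> r"
  have "onorm (\<lambda>h. (DH x h - DH 0 h) + DH 0 h) \<le> onorm (\<lambda>h. DH x h - DH 0 h) + onorm (DH 0)"
    using x r_nonneg by (intro onorm_triangle bounded_linear_sub DH_bl) auto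
  also have "onorm (\<lambda>h. DH x h - DH 0 h) \<le> L * r"
    using DH_lip[of x 0] x r_nonneg mult_left_mono[OF x L_nonneg] by simp
  finally show "onorm (DH x) \<le> L * r + onorm (DH 0)" by simp
qed

lemma G_cont: "continuous_on (cball 0 r) G"
proof -
  have "continuous_on (cball 0 r) H"
    using H_deriv by (rule has_derivative_continuous_on)
  moreover have "\<eta>-lipschitz_on (cball 0 r) (\<lambda>x. G x - H x)"
    by (rule lipschitz_onI) (use G_diff \<eta>_nonneg in \<open>auto simp: dist_norm\<close>)
  ultimately have "continuous_on (cball 0 r) (\<lambda>x. H x + (G x - H x))"
    by (intro continuous_on_add) (auto dest: lipschitz_on_continuous_on)
  then show ?thesis by simp
qed

lemma G_lipschitz: "\<exists>\<Lambda>\<ge>0. \<forall>a b. norm a \<le> r \<longrightarrow> norm b \<le> r \<longrightarrow> norm (G a - G b) \<le> \<Lambda> * norm (a - b)"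
proof -
  obtain A where A: "A \<ge> 0" "\<And>x. norm x \<le> r \<Longrightarrow> onorm (DH x) \<le> A"
    using DH_bounded by blast
  have "norm (G a - G b) \<le> (A + \<eta>) * norm (a - b)" if ab: "norm a \<le> r" "norm b \<le> r" for a b
  proof -
    have "norm (H a - H b) \<le> A * norm (a - b)"
      by (rule differentiable_bound[OF convex_cball H_deriv]) (use A ab in auto)
    moreover have "norm ((G a - H a) - (G b - H b)) \<le> \<eta> * norm (a - b)"
      using G_diff ab by auto
    moreover have "G a - G b = (H a - H b) + ((G a - H a) - (G b - H b))" by simp
    ultimately show ?thesis
      by (metis (no_types, lifting) add_mono distrib_right norm_triangle_le)
  qed
  moreover have "A + \<eta> \<ge> 0" using A(1) \<eta>_nonneg by simp
  ultimately show ?thesis by blast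
qed

text \<open>The factor has two sources: \<open>L * s\<close> is the linearization error of
  \<open>H\<close>, made small by staying near the base point, and \<open>\<eta>\<close> is the
  mismatch between \<open>G\<close> and \<open>H\<close>, made small by the approximation.\<close>

lemma residual_diff_le:
  assumes "norm a \<le> r" "norm b \<le> r" "norm c \<le> r" "norm (a - c) \<le> s" "norm (b - c) \<le> s"
  shows "norm (G a - G b - DH c (a - b)) \<le> (L * s + \<eta>) * norm (a - b)"
proof -
  have "norm (H a - H b - DH c (a - b)) \<le> L * s * norm (a - b)"
    by (rule linearization_error_le[OF convex_cball H_deriv DH_lip L_nonneg]) (use assms in auto)
  moreover have "norm ((G a - H a) - (G b - H b)) \<le> \<eta> * norm (a - b)"
    using G_diff assms by auto
  moreover have "G a - G b - DH c (a - b)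
      = (H a - H b - DH c (a - b)) + ((G a - H a) - (G b - H b))" by simp
  ultimately show ?thesis
    by (metis (no_types, lifting) add_mono distrib_right norm_triangle_le)
qed

lemma G_minus_H_le: "norm a \<le> r \<Longrightarrow> norm (G a - H a) \<le> \<eta> * norm a"
  using G_diff[of a 0] G_0 r_nonneg by simp

lemma ys_cont: "continuous_on {0..} ys"
  by (rule is_wderiv_continuous_on[OF ys_deriv])

lemma DH_cont:
  assumes "continuous_on {0..} w"
  shows "continuous_on {0..} (\<lambda>t. DH (ys t) (w t))"
  by (rule continuous_on_derivative_apply[where K = "cball 0 r", OF _ DH_lip L_nonneg ys_cont _ assms])
    (use DH_bl ys_in in auto)

section \<open>Dependence on the initial value and uniqueness\<close>

text \<open>The difference solves the linearized equation along \<open>ys\<close> with a source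
  \<open>dv\<close> of L2 norm at most \<open>(L * s + \<eta>) * Wnorm (y - z)\<close>. The
  stability bound then absorbs three quarters of the left side, which leaves the factor
  \<open>4 * C\<close>. Both solutions are measured against the same \<open>ys\<close>, although
  \<open>z\<close> may start elsewhere.\<close>

lemma Wnorm_diff_le_initial:
  assumes y: "Winf y" "is_wderiv y (\<lambda>t. G (y t))" "\<And>t. t \<ge> 0 \<Longrightarrow> norm (y t) \<le> r"
      "\<And>t. t \<ge> 0 \<Longrightarrow> norm (y t - ys t) \<le> s"
    and z: "Winf z" "is_wderiv z (\<lambda>t. G (z t))" "\<And>t. t \<ge> 0 \<Longrightarrow> norm (z t) \<le> r"
      "\<And>t. t \<ge> 0 \<Longrightarrow> norm (z t - ys t) \<le> s"
    and small: "C * (L * s + \<eta>) \<le> 3/4"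
  shows "Wnorm (y - z) \<le> 4 * C * norm (y 0 - z 0)"
proof -
  define dv where "dv t = G (y t) - G (z t) - DH (ys t) ((y - z) t)" for t
  have W: "Winf (y - z)" by (rule Winf_diff(1)[OF y(1) z(1)])
  have s: "s \<ge> 0" using y(4)[of 0] norm_ge_zero[of "y 0 - ys 0"] by linarith
  have Gc: "continuous_on {0..} (\<lambda>t. G (u t))" if "Winf u" "\<And>t. t \<ge> 0 \<Longrightarrow> norm (u t) \<le> r" for u
    by (rule continuous_on_compose2[OF G_cont Winf_continuous[OF that(1)]]) (use that(2) in auto)
  have dvc: "continuous_on {0..} dv"
    unfolding dv_def[abs_def]
    by (intro continuous_on_diff Gc DH_cont Winf_continuous W y z)
  have le: "norm (dv t) \<le> (L * s + \<eta>) * norm ((y - z) t)" if "t \<ge> 0" for t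
    unfolding dv_def using residual_diff_le[of "y t" "z t" "ys t" s] y z ys_in that by auto
  have sq: "sq_int (y - z)" using W by (simp add: Winf_def)
  have k: "L * s + \<eta> \<ge> 0" using L_nonneg s \<eta>_nonneg by simp
  note dv = sq_int_bound1[OF dvc sq k le]
  have "is_wderiv (y - z) (\<lambda>t. DH (ys t) ((y - z) t) + dv t)"
    by (rule is_wderiv_cong[OF is_wderiv_diff[OF y(2) z(2)]]) (simp add: dv_def)
  from lin_bound[OF dv(1) W this]
  have "Wnorm (y - z) \<le> C * (L2norm dv + norm (y 0 - z 0))" by simp
  also have "\<dots> \<le> C * ((L * s + \<eta>) * Wnorm (y - z) + norm (y 0 - z 0))"
    using C_pos order_trans[OF dv(2) mult_left_mono[OF L2norm_le_Wnorm k]]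
    by (intro mult_left_mono add_right_mono) (auto simp: fun_diff_def)
  also have "\<dots> = (C * (L * s + \<eta>)) * Wnorm (y - z) + C * norm (y 0 - z 0)"
    by (simp add: algebra_simps)
  also have "\<dots> \<le> 3/4 * Wnorm (y - z) + C * norm (y 0 - z 0)"
    using mult_right_mono[OF small, of "Wnorm (y - z)"] by simp
  finally show ?thesis by simp
qed

text \<open>\<open>G\<close> is Lipschitz on the ball, so Gronwall applies to the difference. This
  covers every solution that stays in the ball of radius \<open>r\<close>, not only those in the
  contraction ball.\<close>

lemma solution_unique:
  assumes y: "is_wderiv y (\<lambda>t. G (y t))" "\<And>t. t \<ge> 0 \<Longrightarrow> norm (y t) \<le> r"
    and z: "is_wderiv z (\<lambda>t. G (z t))" "\<And>t. t \<ge> 0 \<Longrightarrow> norm (z t) \<le> r"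
    and "y 0 = z 0" "t \<ge> 0"
  shows "y t = z t"
proof -
  obtain \<Lambda> where \<Lambda>: "\<Lambda> \<ge> 0" "\<And>a b. norm a \<le> r \<Longrightarrow> norm b \<le> r \<Longrightarrow> norm (G a - G b) \<le> \<Lambda> * norm (a - b)"
    using G_lipschitz by blast
  note d = is_wderiv_diff[OF y(1) z(1)]
  note c = is_wderiv_continuous_on[OF d]
  have "(y - z) t = 0"
  proof (rule Gronwall_zero[OF c \<Lambda>(1) _ \<open>t \<ge> 0\<close>])
    fix t :: real assume t: "t \<ge> 0"
    have "continuous_on {0..t} (\<lambda>s. \<Lambda> * norm ((y - z) s))"
      by (intro continuous_on_mult_left continuous_on_norm continuous_on_subset[OF c]) auto
    then have i: "(\<lambda>s. \<Lambda> * norm ((y - z) s)) integrable_on {0..t}"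
      by (rule integrable_continuous_real)
    have "(y - z) t = integral {0..t} (\<lambda>s. G (y s) - G (z s))"
      using is_wderivD_integral(2)[OF d t] \<open>y 0 = z 0\<close> by simp
    also have "norm \<dots> \<le> integral {0..t} (\<lambda>s. \<Lambda> * norm ((y - z) s))"
      by (rule integral_norm_bound_integral[OF is_wderivD_integral(1)[OF d t] i])
        (use \<Lambda>(2) y z in auto)
    finally show "norm ((y - z) t) \<le> \<Lambda> * integral {0..t} (\<lambda>s. norm ((y - z) s))"
      by simp
  qed
  then show ?thesis by simp
qed

section \<open>Existence by Picard iteration\<close>

text \<open>\<open>contr\<close> makes the iteration halve distances. Together with
  \<open>self\<close>, which limits the source present at zero correction, it maps the ball of
  radius \<open>\<rho>\<close> into itself: one half of \<open>\<rho>\<close> comes from each.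
  \<open>room\<close> keeps \<open>ys + w\<close> where \<open>G\<close> and \<open>H\<close> are
  controlled.\<close>

lemma solution_exists:
  assumes contr: "C * (L * (Ci * \<rho>) + \<eta>) \<le> 1/2" and self: "C * (\<eta> * L2norm ys) \<le> \<rho> / 2"
    and room: "\<And>t. t \<ge> 0 \<Longrightarrow> norm (ys t) + Ci * \<rho> \<le> r"
  shows "\<exists>w. Winf w \<and> w 0 = 0 \<and> Wnorm w \<le> \<rho> \<and> is_wderiv (\<lambda>t. ys t + w t) (\<lambda>t. G (ys t + w t))"
proof -
  define k where "k = L * (Ci * \<rho>) + \<eta>"
  define R where "R w t = G (ys t + w t) - H (ys t) - DH (ys t) (w t)" for w t
  \<comment> \<open>This uniform bound follows from \<open>Wnorm w \<le> \<rho>\<close> by the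
    embedding, and unlike the norm bound it passes at once to pointwise limits.\<close>
  define ball where "ball w \<longleftrightarrow> (\<forall>t\<ge>0. norm (w t) \<le> Ci * \<rho>)" for w :: "real \<Rightarrow> 'a"
  have \<rho>: "\<rho> \<ge> 0"
  proof -
    have "0 \<le> C * (\<eta> * L2norm ys)" using C_pos \<eta>_nonneg by simp
    then show ?thesis using self by linarith
  qed
  have k: "k \<ge> 0" unfolding k_def using L_nonneg Ci_pos \<rho> \<eta>_nonneg by simp
  have ys_sq: "sq_int ys" using ys_W by (simp add: Winf_def)
  have in_r: "norm (ys t + w t) \<le> r" if "ball w" "t \<ge> 0" for w t
  proof -
    have "norm (w t) \<le> Ci * \<rho>" using that by (simp add: ball_def)
    then show ?thesis
      using norm_triangle_ineq[of "ys t" "w t"] room[OF that(2)] by linarith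
  qed
  have ballI: "ball w" if "Winf w" "Wnorm w \<le> \<rho>" for w
    unfolding ball_def
  proof (intro allI impI)
    fix t :: real assume t: "t \<ge> 0"
    show "norm (w t) \<le> Ci * \<rho>"
      by (rule order_trans[OF emb[OF that(1) t] mult_left_mono[OF that(2)]]) (use Ci_pos in simp)
  qed
  have R_diff: "norm (R w t - R v t) \<le> k * norm (w t - v t)" if "ball w" "ball v" "t \<ge> 0" for w v t
  proof -
    have "linear (DH (ys t))" using DH_bl[OF ys_in[OF that(3)]] by (rule bounded_linear.linear)
    then have "R w t - R v t = G (ys t + w t) - G (ys t + v t) - DH (ys t) ((ys t + w t) - (ys t + v t))"
      by (simp add: R_def linear_diff)
    then show ?thesis
      using residual_diff_le[of "ys t + w t" "ys t + v t" "ys t" "Ci * \<rho>"]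
        in_r[OF that(1,3)] in_r[OF that(2,3)] ys_in[OF that(3)] that
      by (simp add: k_def ball_def)
  qed
  have ball0: "ball (\<lambda>_. 0)" using Ci_pos \<rho> by (simp add: ball_def)
  have R0: "norm (R (\<lambda>_. 0) t) \<le> \<eta> * norm (ys t)" if "t \<ge> 0" for t
    using G_minus_H_le[OF ys_in[OF that]] linear_0[OF bounded_linear.linear[OF DH_bl[OF ys_in[OF that]]]]
    by (simp add: R_def)
  have R_le: "norm (R w t) \<le> k * norm (w t) + \<eta> * norm (ys t)" if "ball w" "t \<ge> 0" for w t
    using R_diff[OF that(1) ball0 that(2)] R0[OF that(2)]
      norm_triangle_ineq[of "R w t - R (\<lambda>_. 0) t" "R (\<lambda>_. 0) t"] by simp
  have R_cont: "continuous_on {0..} (R w)" if "ball w" "continuous_on {0..} w" for w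
  proof -
    have "continuous_on {0..} (\<lambda>t. G (ys t + w t))"
      by (rule continuous_on_compose2[OF G_cont continuous_on_add[OF ys_cont that(2)]])
        (use in_r[OF that(1)] in auto)
    moreover have "continuous_on {0..} (\<lambda>t. H (ys t))"
      by (rule continuous_on_compose2[OF has_derivative_continuous_on[OF H_deriv] ys_cont])
        (use ys_in in auto)
    ultimately show ?thesis
      unfolding R_def[abs_def] by (intro continuous_on_diff DH_cont that(2))
  qed
  \<comment> \<open>One a priori estimate serves twice: for a Picard step, and for the limit
    \<open>v\<close> with \<open>w' = w = v\<close>.\<close>
  have solve: "Wnorm w' \<le> C * (k * L2norm w + \<eta> * L2norm ys)"
    if "sq_int w" "ball w" "continuous_on {0..} w" "Winf w'" "w' 0 = 0"
      "is_wderiv w' (\<lambda>t. DH (ys t) (w' t) + R w t)" for w w'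
  proof -
    note b = sq_int_bound2[OF R_cont[OF that(2,3)] that(1) ys_sq k \<eta>_nonneg R_le[OF that(2)]]
    from lin_bound[OF b(1) that(4,6)] have "Wnorm w' \<le> C * L2norm (R w)"
      using that(5) by simp
    also have "\<dots> \<le> C * (k * L2norm w + \<eta> * L2norm ys)"
      using b(2) C_pos by (intro mult_left_mono) auto
    finally show ?thesis .
  qed

  define P where "P w \<longleftrightarrow> Winf w \<and> w 0 = 0 \<and> Wnorm w \<le> \<rho>" for w :: "real \<Rightarrow> 'a"
  have P0: "P (\<lambda>_. 0)"
  proof -
    have sq: "sq_int (\<lambda>_. 0 :: 'a)"
      by (simp add: sq_int_def set_borel_measurable_def set_integrable_def)
    have wd: "is_wderiv (\<lambda>_. 0 :: 'a) (\<lambda>_. 0)"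
      by (rule is_wderivI) (simp_all add: set_integrable_def set_lebesgue_integral_def)
    have "Wnorm (\<lambda>_. 0 :: 'a) = 0"
      using Wnorm_eq[OF wd sq] by (simp add: L2norm_def set_lebesgue_integral_def)
    moreover have "Winf (\<lambda>_. 0 :: 'a)" using sq wd unfolding Winf_def by blast
    ultimately show ?thesis using \<rho> by (simp add: P_def)
  qed
  have step: "\<exists>w'. P w' \<and> is_wderiv w' (\<lambda>t. DH (ys t) (w' t) + R w t)" if "P w" for w
  proof -
    have w: "sq_int w" "ball w" "continuous_on {0..} w" "L2norm w \<le> \<rho>"
      using that ballI Winf_continuous order_trans[OF L2norm_le_Wnorm]
      by (auto simp: P_def Winf_def)
    have "sq_int (R w)"
      by (rule sq_int_bound2[OF R_cont[OF w(2,3)] w(1) ys_sq k \<eta>_nonneg R_le[OF w(2)]])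
    from lin_ex[OF this] obtain w' where w': "Winf w'" "w' 0 = 0"
      "is_wderiv w' (\<lambda>t. DH (ys t) (w' t) + R w t)" by blast
    have "Wnorm w' \<le> C * (k * L2norm w + \<eta> * L2norm ys)"
      by (rule solve[OF w(1,2,3) w'])
    also have "\<dots> = (C * k) * L2norm w + C * (\<eta> * L2norm ys)"
      by (simp add: algebra_simps)
    also have "\<dots> \<le> 1/2 * \<rho> + \<rho> / 2"
      using contr self w(4) C_pos k by (intro add_mono mult_mono) (auto simp: k_def)
    finally show ?thesis using w' by (auto simp: P_def)
  qed
  obtain w where w0: "w 0 = (\<lambda>_. 0)" and wP: "\<And>n. P (w n)"
    and wS: "\<And>n. is_wderiv (w (Suc n)) (\<lambda>t. DH (ys t) (w (Suc n) t) + R (w n) t)"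
  proof -
    obtain F where F: "\<And>w. P w \<Longrightarrow> P (F w) \<and> is_wderiv (F w) (\<lambda>t. DH (ys t) (F w t) + R w t)"
      using step by metis
    define w where "w n = (F ^^ n) (\<lambda>_. 0)" for n
    have "P (w n)" for n by (induction n) (use P0 F in \<open>auto simp: w_def\<close>)
    with F show ?thesis by (intro that[of w]) (auto simp: w_def)
  qed
  have W: "Winf (w n)" "Wnorm (w n) \<le> \<rho>" "w n 0 = 0" "ball (w n)" "sq_int (w n)"
    "continuous_on {0..} (w n)" "L2norm (w n) \<le> \<rho>" for n
    using wP[of n] ballI Winf_continuous order_trans[OF L2norm_le_Wnorm]
    by (auto simp: P_def Winf_def)
  have geo: "Wnorm (w (Suc n) - w n) \<le> (1/2) ^ n * (2 * \<rho>)" for n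
  proof (induction n)
    case 0
    \<comment> \<open>Both iterates have norm at most \<open>\<rho>\<close>, whence the factor
      2.\<close>
    have "Wnorm (w (Suc 0) - w 0) \<le> 2 * \<rho>"
      using Winf_diff(2)[OF W(1)[of "Suc 0"] W(1)[of 0]] W(2)[of "Suc 0"] W(2)[of 0] by linarith
    then show ?case by (simp only: power_0 mult_1)
  next
    case (Suc n)
    let ?d = "w (Suc (Suc n)) - w (Suc n)" and ?e = "w (Suc n) - w n"
    let ?dv = "\<lambda>t. R (w (Suc n)) t - R (w n) t"
    have sq: "sq_int ?e" using Winf_diff(1)[OF W(1) W(1)] by (simp add: Winf_def)
    have dvc: "continuous_on {0..} ?dv"
      by (intro continuous_on_diff R_cont W)
    have dvle: "norm (?dv t) \<le> k * norm (?e t)" if "t \<ge> 0" for t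
      using R_diff[OF W(4) W(4) that, of "Suc n" n] by simp
    note b = sq_int_bound1[OF dvc sq k dvle]
    \<comment> \<open>Consecutive differences solve the linear equation with the difference of the
      residuals as source and zero initial value, so the stability bound turns the small constant
      \<open>k\<close> into a contraction.\<close>
    have "is_wderiv ?d (\<lambda>t. DH (ys t) (?d t) + ?dv t)"
    proof (rule is_wderiv_cong[OF is_wderiv_diff[OF wS[of "Suc n"] wS[of n]]])
      fix t :: real assume "t \<ge> 0"
      then have "linear (DH (ys t))" using DH_bl[OF ys_in] bounded_linear.linear by blast
      then show "DH (ys t) (w (Suc (Suc n)) t) + R (w (Suc n)) t - (DH (ys t) (w (Suc n) t) + R (w n) t)
          = DH (ys t) (?d t) + ?dv t"
        by (simp add: linear_diff)
    qed
    from lin_bound[OF b(1) Winf_diff(1)[OF W(1) W(1)] this]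
    have "Wnorm ?d \<le> C * L2norm ?dv" by (simp add: W(3))
    also have "\<dots> \<le> C * (k * Wnorm ?e)"
      by (rule mult_left_mono[OF order_trans[OF b(2) mult_left_mono[OF L2norm_le_Wnorm k]]])
        (use C_pos in simp_all)
    also have "\<dots> \<le> 1/2 * Wnorm ?e"
      using mult_right_mono[OF contr, of "Wnorm ?e"] by (simp add: k_def mult_ac)
    also have "\<dots> \<le> 1/2 * ((1/2) ^ n * (2 * \<rho>))"
      by (rule mult_left_mono[OF Suc.IH]) simp
    also have "\<dots> = (1/2) ^ Suc n * (2 * \<rho>)" by simp
    finally show ?case .
  qed
  \<comment> \<open>The embedding turns geometric decay in \<open>Wnorm\<close> into summability of
    the increments at each time; their sums telescope to \<open>w n t\<close> because
    \<open>w 0\<close> is zero.\<close>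
  have "\<exists>l. (\<lambda>n. w n t) \<longlonglongrightarrow> l" if t: "t \<ge> 0" for t
  proof -
    have "summable (\<lambda>n. w (Suc n) t - w n t)"
    proof (rule summable_comparison_test')
      show "summable (\<lambda>n. Ci * ((1/2) ^ n * (2 * \<rho>)))"
        by (intro summable_mult summable_mult2 summable_geometric) simp
      show "norm (w (Suc n) t - w n t) \<le> Ci * ((1/2) ^ n * (2 * \<rho>))" for n
      proof -
        have "norm (w (Suc n) t - w n t) \<le> Ci * Wnorm (w (Suc n) - w n)"
          using emb[OF Winf_diff(1)[OF W(1) W(1)] t, of "Suc n" n] by simp
        also have "\<dots> \<le> Ci * ((1/2) ^ n * (2 * \<rho>))"
          by (rule mult_left_mono[OF geo]) (use Ci_pos in simp)
        finally show ?thesis .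
      qed
    qed
    then have "convergent (\<lambda>n. \<Sum>i<n. w (Suc i) t - w i t)"
      by (simp add: summable_iff_convergent)
    moreover have "(\<Sum>i<n. w (Suc i) t - w i t) = w n t" for n
      by (induction n) (simp_all add: w0)
    ultimately show ?thesis
      by (simp add: convergent_def)
  qed
  then obtain v where v: "\<And>t. t \<ge> 0 \<Longrightarrow> (\<lambda>n. w n t) \<longlonglongrightarrow> v t" by metis
  have v_ball: "ball v"
    unfolding ball_def
  proof (intro allI impI)
    fix t :: real assume t: "t \<ge> 0"
    show "norm (v t) \<le> Ci * \<rho>"
      by (rule LIMSEQ_le_const2[OF tendsto_norm[OF v[OF t]]]) (use W(4) t in \<open>auto simp: ball_def\<close>)
  qed
  have v_sq: "sq_int v" by (rule sq_int_limit[OF W(5) W(7) v])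
  have v0: "v 0 = 0"
    using v[of 0] by (simp add: W(3) LIMSEQ_const_iff)
  obtain A where A: "A \<ge> 0" "\<And>x. norm x \<le> r \<Longrightarrow> onorm (DH x) \<le> A"
    using DH_bounded by blast
  have DH_le: "norm (DH (ys t) h) \<le> A * norm h" if "t \<ge> 0" for t h
    using onorm[OF DH_bl[OF ys_in[OF that]], of h] mult_right_mono[OF A(2)[OF ys_in[OF that]], of "norm h"]
    by simp
  let ?g = "\<lambda>t. DH (ys t) (v t) + R v t"
  \<comment> \<open>Passage to the limit in the integral form of the equation. On
    \<open>{0..t}\<close> the right-hand sides are bounded by the constant \<open>?c\<close>, so
    dominated convergence applies.\<close>
  have v_deriv: "is_wderiv v ?g"
  proof -
    let ?F = "\<lambda>n t. DH (ys t) (w (Suc n) t) + R (w n) t"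
    let ?c = "A * (Ci * \<rho>) + (k * (Ci * \<rho>) + \<eta> * r)"
    have lim: "(\<lambda>n. ?F n t) \<longlonglongrightarrow> ?g t" if t: "t \<ge> 0" for t
    proof -
      have D: "(\<lambda>n. DH (ys t) (w n t)) \<longlonglongrightarrow> DH (ys t) (v t)"
        by (rule bounded_linear.tendsto[OF DH_bl[OF ys_in[OF t]] v[OF t]])
      have "(\<lambda>n. G (ys t + w n t)) \<longlonglongrightarrow> G (ys t + v t)"
        by (rule continuous_on_tendsto_compose[OF G_cont tendsto_add[OF tendsto_const v[OF t]]])
          (use in_r[OF v_ball t] in_r[OF W(4) t] in auto)
      then show ?thesis
        unfolding R_def by (intro tendsto_add tendsto_diff tendsto_const D LIMSEQ_Suc[OF D])
    qed
    have bd: "norm (?F n t) \<le> ?c" if t: "t \<ge> 0" for n t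
    proof -
      have wn: "norm (w m t) \<le> Ci * \<rho>" for m using W(4)[of m] t by (simp add: ball_def)
      have "norm (DH (ys t) (w (Suc n) t)) \<le> A * (Ci * \<rho>)"
        using DH_le[OF t, of "w (Suc n) t"] mult_left_mono[OF wn A(1)] by (rule order_trans)
      moreover have "norm (R (w n) t) \<le> k * (Ci * \<rho>) + \<eta> * r"
        using R_le[OF W(4) t, of n] add_mono[OF mult_left_mono[OF wn k] mult_left_mono[OF ys_in[OF t] \<eta>_nonneg]]
        by (rule order_trans)
      ultimately show ?thesis by (rule norm_add_rule_thm)
    qed
    have conv: "set_integrable lborel {0..t} ?g \<and>
        (\<lambda>n. LINT s:{0..t}|lborel. ?F n s) \<longlonglongrightarrow> (LINT s:{0..t}|lborel. ?g s)" if t: "t \<ge> 0" for t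
    proof -
      let ?f = "\<lambda>n s. indicator {0..t} s *\<^sub>R ?F n s" and ?h = "\<lambda>s. indicator {0..t} s *\<^sub>R ?g s"
      have m: "?f n \<in> borel_measurable lborel" for n
        using is_wderivD(1)[OF wS[of n] t] unfolding set_integrable_def by (rule borel_measurable_integrable)
      have l: "(\<lambda>n. ?f n s) \<longlonglongrightarrow> ?h s" for s
        by (cases "s \<in> {0..t}") (use lim[of s] in auto)
      have mh: "?h \<in> borel_measurable lborel"
        by (rule borel_measurable_LIMSEQ_metric[OF m l])
      have b: "norm (?f n s) \<le> indicator {0..t} s *\<^sub>R ?c" for n s
        by (cases "s \<in> {0..t}") (use bd[of s n] in auto)
      have ic: "integrable lborel (\<lambda>s. indicator {0..t} s *\<^sub>R ?c)"
        using borel_integrable_atLeastAtMost'[OF continuous_on_const, of 0 t ?c]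
        by (simp add: set_integrable_def)
      have l': "AE s in lborel. (\<lambda>n. ?f n s) \<longlonglongrightarrow> ?h s" and b': "\<And>n. AE s in lborel. norm (?f n s) \<le> indicator {0..t} s *\<^sub>R ?c"
        using l b by auto
      show ?thesis
        unfolding set_integrable_def set_lebesgue_integral_def
        using integrable_dominated_convergence[OF mh m ic l' b']
          integral_dominated_convergence[OF mh m ic l' b'] by blast
    qed
    show ?thesis
    proof (rule is_wderivI)
      fix t :: real assume t: "t \<ge> 0"
      show "set_integrable lborel {0..t} ?g" using conv[OF t] by blast
      have "w (Suc n) t = (LINT s:{0..t}|lborel. ?F n s)" for n
        using is_wderivD(2)[OF wS[of n] t] by (simp add: W(3))
      then have "(\<lambda>n. w (Suc n) t) \<longlonglongrightarrow> (LINT s:{0..t}|lborel. ?g s)"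
        using conv[OF t] by simp
      then show "v t - v 0 = (LINT s:{0..t}|lborel. ?g s)"
        using LIMSEQ_unique[OF LIMSEQ_Suc[OF v[OF t]]] by (simp add: v0)
    qed
  qed
  have v_cont: "continuous_on {0..} v" by (rule is_wderiv_continuous_on[OF v_deriv])
  have "sq_int ?g"
  proof (rule sq_int_bound2)
    show "continuous_on {0..} ?g" by (intro continuous_on_add DH_cont R_cont v_ball v_cont)
    show "norm (?g t) \<le> (A + k) * norm (v t) + \<eta> * norm (ys t)" if t: "t \<ge> 0" for t
      using norm_triangle_ineq[of "DH (ys t) (v t)" "R v t"] DH_le[OF t, of "v t"] R_le[OF v_ball t]
      by (simp add: algebra_simps)
  qed (use v_sq ys_sq A(1) k \<eta>_nonneg in auto)
  then have v_W: "Winf v" using v_sq v_deriv unfolding Winf_def by blast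
  \<comment> \<open>Fatou only gave square integrability of \<open>v\<close>. Its norm bound comes
    from the fixed point equation, by absorbing half of \<open>Wnorm v\<close>.\<close>
  have "Wnorm v \<le> C * (k * L2norm v + \<eta> * L2norm ys)"
    by (rule solve[OF v_sq v_ball v_cont v_W v0 v_deriv])
  also have "\<dots> = (C * k) * L2norm v + C * (\<eta> * L2norm ys)"
    by (simp add: algebra_simps)
  also have "\<dots> \<le> 1/2 * Wnorm v + \<rho> / 2"
    using contr self C_pos k L2norm_le_Wnorm[of v] by (intro add_mono mult_mono) (auto simp: k_def)
  finally have "Wnorm v \<le> \<rho>" by simp
  moreover have "is_wderiv (\<lambda>t. ys t + v t) (\<lambda>t. G (ys t + v t))"
    by (rule is_wderiv_cong[OF is_wderiv_add[OF ys_deriv v_deriv]]) (simp add: R_def)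
  ultimately show ?thesis using v_W v0 by blast
qed

end

section \<open>The closed-loop system of the network\<close>

text \<open>A differentiable map is continuous, here with values measured in the supremum norm. The
  derivative is given only as a pointwise linear map into W, so its boundedness is first recovered
  from its values on the basis.\<close>

lemma uniformly_close_if_differentiable:
  fixes ystar :: "'a::euclidean_space \<Rightarrow> real \<Rightarrow> 'b::euclidean_space"
  assumes emb: "\<And>y t. Winf (y :: real \<Rightarrow> 'b) \<Longrightarrow> t \<ge> 0 \<Longrightarrow> norm (y t) \<le> Ci * Wnorm y" and Ci: "Ci > 0"
    and N: "open N" "x \<in> N" and W: "\<And>z. z \<in> N \<Longrightarrow> Winf (ystar z)"
    and DW: "\<And>h. Winf (D h)" and lin: "\<And>t. t \<ge> 0 \<Longrightarrow> linear (\<lambda>h. D h t)"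
    and lim: "((\<lambda>h. Wnorm (ystar (x + h) - ystar x - D h) / norm h) \<longlongrightarrow> 0) (at 0)"
    and s: "s > 0"
  shows "\<exists>d>0. \<forall>z. dist x z < d \<longrightarrow> (\<forall>t\<ge>0. norm (ystar z t - ystar x t) \<le> s)"
proof -
  define A where "A = (\<Sum>e\<in>Basis. Ci * Wnorm (D e))"
  have A: "A \<ge> 0" unfolding A_def using Ci by (intro sum_nonneg) simp
  have D_le: "norm (D h t) \<le> A * norm h" if t: "t \<ge> 0" for h t
  proof -
    have "D h t = D (\<Sum>e\<in>Basis. (h \<bullet> e) *\<^sub>R e) t" by (simp only: euclidean_representation)
    also have "\<dots> = (\<Sum>e\<in>Basis. (h \<bullet> e) *\<^sub>R D e t)"
      by (simp add: linear_sum[OF lin[OF t]] linear_cmul[OF lin[OF t]])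
    also have "norm \<dots> \<le> (\<Sum>e\<in>Basis. norm h * (Ci * Wnorm (D e)))"
    proof (rule sum_norm_le)
      fix e :: 'a assume "e \<in> Basis"
      then show "norm ((h \<bullet> e) *\<^sub>R D e t) \<le> norm h * (Ci * Wnorm (D e))"
        using emb[OF DW t] Ci Basis_le_norm by (auto intro!: mult_mono)
    qed
    finally show ?thesis by (simp add: A_def sum_distrib_left mult.commute)
  qed
  obtain d1 where d1: "d1 > 0"
    "\<And>h. h \<noteq> 0 \<Longrightarrow> norm h < d1 \<Longrightarrow> Wnorm (ystar (x + h) - ystar x - D h) / norm h < 1"
    using tendstoD[OF lim, of 1] by (auto simp: eventually_at)
  obtain d2 where d2: "d2 > 0" "ball x d2 \<subseteq> N" using openE[OF N] by blast
  \<comment> \<open>\<open>d1\<close> bounds the remainder by \<open>norm h\<close>,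
    \<open>d2\<close> keeps \<open>z\<close> inside \<open>N\<close>, and the last term makes
    \<open>(Ci + A) * norm h\<close> at most \<open>s\<close>.\<close>
  define d where "d = min (min d1 d2) (s / (Ci + A))"
  have "d > 0" using d1(1) d2(1) s Ci A by (simp add: d_def)
  moreover have "norm (ystar z t - ystar x t) \<le> s" if z: "dist x z < d" and t: "t \<ge> 0" for z t
  proof (cases "z = x")
    case True
    then show ?thesis using s by simp
  next
    case False
    define h where "h = z - x"
    have h: "h \<noteq> 0" "norm h < d1" "norm h < s / (Ci + A)" "x + h = z" "z \<in> N"
      using False z d2(2) by (auto simp: h_def d_def dist_norm norm_minus_commute)
    let ?q = "ystar z - ystar x - D h"
    have "Wnorm ?q \<le> norm h"
      using d1(2)[OF h(1,2)] h(1) unfolding h(4) by (simp add: divide_simps)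
    have "norm (?q t) \<le> Ci * Wnorm ?q"
      by (rule emb[OF Winf_diff(1)[OF Winf_diff(1)[OF W W] DW] t]) (use N h in auto)
    also have "\<dots> \<le> Ci * norm h"
      by (rule mult_left_mono[OF \<open>Wnorm ?q \<le> norm h\<close>]) (use Ci in simp)
    finally have "norm (?q t) + norm (D h t) \<le> (Ci + A) * norm h"
      using D_le[OF t, of h] by (simp add: algebra_simps)
    also have "\<dots> \<le> s"
      using h(3) Ci A by (simp add: pos_less_divide_eq mult.commute)
    finally show ?thesis
      using norm_triangle_ineq[of "?q t" "D h t"] by simp
  qed
  ultimately show ?thesis by blast
qed

lemma onorm_diff_add_comp_le:
  fixes B :: "'b::real_normed_vector \<Rightarrow> 'c::real_normed_vector"
    and Q1 Q2 :: "'a::euclidean_space \<Rightarrow> 'b"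
  assumes bl: "bounded_linear P1" "bounded_linear P2" "bounded_linear Q1" "bounded_linear Q2"
    and B: "linear B" "\<And>x. norm (B x) \<le> b * norm x" "b \<ge> 0"
    and le: "onorm (\<lambda>h. P1 h - P2 h) \<le> p" "onorm (\<lambda>h. Q1 h - Q2 h) \<le> q"
  shows "onorm (\<lambda>h. (P1 h + B (Q1 h)) - (P2 h + B (Q2 h))) \<le> p + b * q"
proof (rule onorm_le)
  fix h
  have "norm (P1 h - P2 h) \<le> p * norm h"
    using onorm[OF bounded_linear_sub[OF bl(1,2)], of h] mult_right_mono[OF le(1), of "norm h"] by simp
  moreover have "norm (Q1 h - Q2 h) \<le> q * norm h"
    using onorm[OF bounded_linear_sub[OF bl(3,4)], of h] mult_right_mono[OF le(2), of "norm h"] by simp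
  then have "norm (B (Q1 h - Q2 h)) \<le> b * (q * norm h)"
    using B(2)[of "Q1 h - Q2 h"] mult_left_mono[OF _ B(3)] by (meson order_trans)
  moreover have "(P1 h + B (Q1 h)) - (P2 h + B (Q2 h)) = (P1 h - P2 h) + B (Q1 h - Q2 h)"
    by (simp add: linear_diff[OF B(1)])
  ultimately show "norm ((P1 h + B (Q1 h)) - (P2 h + B (Q2 h))) \<le> (p + b * q) * norm h"
    using norm_triangle_ineq[of "P1 h - P2 h" "B (Q1 h - Q2 h)"] by (simp add: algebra_simps)
qed

text \<open>The derivative part of the approximation bound, through the mean value inequality on the
  ball. Since both maps vanish at the origin in the application, the error is at most
  \<open>\<epsilon> * norm x\<close> and hence square integrable along trajectories, which a
  constant error would not be.\<close>

lemma eps_approx_lipschitz: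
  fixes F :: "'a::euclidean_space \<Rightarrow> 'b::euclidean_space"
  assumes \<sigma>: "\<sigma> C1_differentiable_on UNIV" and approx: "eps_approx F DF \<sigma> R \<theta> \<epsilon>"
    and F: "\<And>x. x \<in> cball 0 (2 * R) \<Longrightarrow> (F has_derivative DF x) (at x within cball 0 (2 * R))"
    and ab: "a \<in> cball 0 (2 * R)" "b \<in> cball 0 (2 * R)"
  shows "norm ((F a - Fnet \<sigma> \<theta> a) - (F b - Fnet \<sigma> \<theta> b)) \<le> \<epsilon> * norm (a - b)"
proof (rule differentiable_bound[OF convex_cball _ _ ab])
  let ?N = "Fnet \<sigma> \<theta> :: 'a \<Rightarrow> 'b"
  fix x :: 'a assume x: "x \<in> cball 0 (2 * R)"
  have "(?N has_derivative frechet_derivative ?N (at x)) (at x within cball 0 (2 * R))"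
    by (rule has_derivative_at_withinI[OF frechet_derivative_works[THEN iffD1, OF Fnet_differentiable[OF \<sigma>]]])
  then show "((\<lambda>x. F x - ?N x) has_derivative (\<lambda>h. DF x h - frechet_derivative ?N (at x) h))
      (at x within cball 0 (2 * R))"
    by (intro has_derivative_diff F x)
  have "norm (F x - ?N x) + onorm (\<lambda>h. DF x h - frechet_derivative ?N (at x) h) \<le> \<epsilon>"
    using approx x by (simp add: eps_approx_def)
  then show "onorm (\<lambda>h. DF x h - frechet_derivative ?N (at x) h) \<le> \<epsilon>"
    using norm_ge_zero[of "F x - ?N x"] by linarith
qed

section \<open>Choice of the constants and assembly of the closed-loop result\<close>

theorem mainTheorem12:
  fixes f :: "'a::euclidean_space \<Rightarrow> 'a" and Df :: "'a \<Rightarrow> 'a \<Rightarrow> 'a"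
    and B :: "'b::euclidean_space \<Rightarrow> 'a" and Q :: "'a \<Rightarrow> 'a" and \<beta> :: real
    and Y0 :: "'a set" and NY0 :: "'a set"
    and Fs :: "'a \<Rightarrow> 'b" and DFs :: "'a \<Rightarrow> 'a \<Rightarrow> 'b"
    and ystar :: "'a \<Rightarrow> real \<Rightarrow> 'a" and Dystar :: "'a \<Rightarrow> 'a \<Rightarrow> real \<Rightarrow> 'a"
    and M Ci MY0 Mhat :: real
    and \<sigma> :: "real \<Rightarrow> real" and \<theta> :: "real \<Rightarrow> network"
    and \<mu> :: "'a measure"
  defines "MY0 \<equiv> M * (SUP y\<in>Y0. norm y)"
      and "Mhat \<equiv> Ci * MY0"
  assumes B_lin: "linear B"
      and Q_lin: "linear Q" and Q_sym: "\<forall>x y. Q x \<bullet> y = x \<bullet> Q y" and Q_psd: "\<forall>x. 0 \<le> x \<bullet> Q x"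
      and \<beta>_pos: "\<beta> > 0"
      \<comment> \<open>embedding constant C_i\<close>
      and Ci_pos: "Ci > 0"
      and Ci_emb: "\<forall>y::real \<Rightarrow> 'a. Winf y \<longrightarrow> (\<forall>t\<ge>0. norm (y t) \<le> Ci * Wnorm y)"
      \<comment> \<open>Standing Assumption 1\<close>
      and Y0_compact: "compact Y0" and Y0_0: "0 \<in> Y0"
      \<comment> \<open>(A.1)\<close>
      and f_deriv: "\<forall>x. (f has_derivative Df x) (at x)"
      and f_0: "f 0 = 0"
      and Df_lip: "\<forall>K. compact K \<longrightarrow>
                     (\<exists>L. \<forall>x\<in>K. \<forall>z\<in>K. onorm (\<lambda>h. Df x h - Df z h) \<le> L * norm (x - z))"
      \<comment> \<open>(A.2)\<close>
      and N_open: "open NY0" and N_sup: "Y0 \<subseteq> NY0"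
      and Fs_0: "Fs 0 = 0"
      and A2: "\<forall>y0\<in>NY0. cl_sol f B Fs y0 (ystar y0) \<and>
                  (\<forall>z. cl_sol f B Fs y0 z \<longrightarrow> (\<forall>t\<ge>0. z t = ystar y0 t)) \<and>
                  is_minimizer f B Q \<beta> y0 (ystar y0) (\<lambda>t. Fs (ystar y0 t))"
      \<comment> \<open>(A.3): continuous Frechet differentiability of y0 \<mapsto> y*(y0) into W_infinity, and the bound\<close>
      and A3_deriv: "\<forall>y0\<in>NY0. (\<forall>h. Winf (Dystar y0 h)) \<and> (\<forall>t\<ge>0. linear (\<lambda>h. Dystar y0 h t)) \<and>
                  ((\<lambda>h. Wnorm (ystar (y0 + h) - ystar y0 - Dystar y0 h) / norm h) \<longlongrightarrow> 0) (at 0)"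
      and A3_cont: "\<forall>y0\<in>NY0. \<forall>e>0. \<exists>d>0. \<forall>y1\<in>NY0. norm (y1 - y0) < d \<longrightarrow>
                  (\<forall>h. Wnorm (Dystar y1 h - Dystar y0 h) \<le> e * norm h)"
      and M_pos: "M > 0"
      and A3_bound: "\<forall>y0\<in>NY0. Wnorm (ystar y0) \<le> M * norm y0"
      \<comment> \<open>(A.4): F* is C^1 on the closed ball with Lipschitz derivative DFs\<close>
      and A4_deriv: "\<forall>x\<in>cball 0 (2 * Mhat). (Fs has_derivative DFs x) (at x within cball 0 (2 * Mhat))"
      and A4_lip: "\<exists>L. \<forall>x\<in>cball 0 (2 * Mhat). \<forall>z\<in>cball 0 (2 * Mhat).
                     onorm (\<lambda>h. DFs x h - DFs z h) \<le> L * norm (x - z)"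
      \<comment> \<open>Assumption 3\<close>
      and Ass3: "\<exists>C>0. \<forall>y0\<in>NY0. \<forall>dy0. \<forall>dv. sq_int dv \<longrightarrow>
                  unique_on_I (\<lambda>dy. Winf dy \<and> dy 0 = dy0 \<and>
                     is_wderiv dy (\<lambda>t. Df (ystar y0 t) (dy t) + B (DFs (ystar y0 t) (dy t)) + dv t)) \<and>
                  (\<forall>dy. Winf dy \<and> dy 0 = dy0 \<and>
                     is_wderiv dy (\<lambda>t. Df (ystar y0 t) (dy t) + B (DFs (ystar y0 t) (dy t)) + dv t)
                     \<longrightarrow> Wnorm dy \<le> C * (L2norm dv + norm dy0))"
      \<comment> \<open>probability space on Y0\<close>
      and \<mu>_prob: "prob_space \<mu>" and \<mu>_space: "space \<mu> = Y0"
      and \<mu>_complete: "complete_measure \<mu>"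
      and \<mu>_borel: "sets (restrict_space borel Y0) \<subseteq> sets \<mu>"
      \<comment> \<open>activation and approximating networks\<close>
      and \<sigma>_C1: "\<sigma> C1_differentiable_on UNIV"
      and \<theta>_approx: "\<forall>\<epsilon>>0. eps_approx Fs DFs \<sigma> Mhat (\<theta> \<epsilon>) \<epsilon>"
  shows "\<exists>\<epsilon>1>0. \<exists>c>0. \<forall>\<epsilon>. 0 < \<epsilon> \<and> \<epsilon> < \<epsilon>1 \<longrightarrow>
           (\<exists>Y :: 'a \<Rightarrow> real \<Rightarrow> 'a.
              (\<forall>y0\<in>Y0.
                 cl_sol f B (Fnet \<sigma> (\<theta> \<epsilon>)) y0 (Y y0) \<and> Wnorm (Y y0) \<le> 2 * MY0 \<and>
                 (\<forall>z. cl_sol f B (Fnet \<sigma> (\<theta> \<epsilon>)) y0 z \<and> Wnorm z \<le> 2 * MY0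
                      \<longrightarrow> (\<forall>t\<ge>0. z t = Y y0 t)) \<and>
                 Wnorm (ystar y0 - Y y0) \<le> c * \<epsilon> \<and>
                 Wnorm (Y y0) \<le> 3/2 * M * norm y0) \<and>
              in_Linf_W \<mu> Y \<and> Linf_W_norm \<mu> Y \<le> ereal (3/2 * MY0))"
proof -
  \<comment> \<open>By the embedding, \<open>2 * Mhat\<close> bounds the values of every function
    with \<open>Wnorm\<close> at most \<open>2 * MY0\<close>, so this ball contains all admissible
    states.\<close>
  define r where "r = 2 * Mhat"
  have norm_le: "norm y \<le> (SUP y\<in>Y0. norm y)" if "y \<in> Y0" for y
    by (rule cSUP_upper[OF that])
      (use compact_imp_bounded[OF Y0_compact] in \<open>auto simp: bounded_iff bdd_above_def\<close>)
  have My0: "M * norm y \<le> MY0" if "y \<in> Y0" for y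
    unfolding MY0_def using norm_le[OF that] M_pos by simp
  have MY0: "MY0 \<ge> 0" using My0[OF Y0_0] by simp
  have blB: "bounded_linear B" using B_lin by (simp add: linear_conv_bounded_linear)
  obtain b where b: "b > 0" "\<And>x. norm (B x) \<le> b * norm x"
    using bounded_linear.pos_bounded[OF blB] by (metis mult.commute)
  obtain Lf where Lf: "\<And>x z. x \<in> cball 0 r \<Longrightarrow> z \<in> cball 0 r \<Longrightarrow>
      onorm (\<lambda>h. Df x h - Df z h) \<le> Lf * norm (x - z)"
    using Df_lip[rule_format, OF compact_cball[of 0 r]] by blast
  obtain LF where LF: "\<And>x z. x \<in> cball 0 r \<Longrightarrow> z \<in> cball 0 r \<Longrightarrow>
      onorm (\<lambda>h. DFs x h - DFs z h) \<le> LF * norm (x - z)"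
    using A4_lip unfolding r_def by blast
  \<comment> \<open>The Lipschitz hypotheses do not fix the sign of their constants, hence the
    absolute values.\<close>
  define L where "L = \<bar>Lf\<bar> + b * \<bar>LF\<bar>"
  have L: "L \<ge> 0" using b(1) by (simp add: L_def)
  define H where "H x = f x + B (Fs x)" for x
  define DH where "DH x h = Df x h + B (DFs x h)" for x h
  have Fs_deriv: "(Fs has_derivative DFs x) (at x within cball 0 r)" if "x \<in> cball 0 r" for x
    using A4_deriv that unfolding r_def by blast
  have H_deriv: "(H has_derivative DH x) (at x within cball 0 r)" if "x \<in> cball 0 r" for x
    unfolding H_def[abs_def] DH_def[abs_def]
    by (intro has_derivative_add has_derivative_at_withinI[OF f_deriv[rule_format]]
        bounded_linear.has_derivative[OF blB] Fs_deriv that)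
  have DH_lip: "onorm (\<lambda>h. DH x h - DH z h) \<le> L * norm (x - z)"
    if "x \<in> cball 0 r" "z \<in> cball 0 r" for x z
  proof -
    have "onorm (\<lambda>h. DH x h - DH z h) \<le> \<bar>Lf\<bar> * norm (x - z) + b * (\<bar>LF\<bar> * norm (x - z))"
      unfolding DH_def
    proof (rule onorm_diff_add_comp_le[OF _ _ _ _ B_lin b(2)])
      show "onorm (\<lambda>h. Df x h - Df z h) \<le> \<bar>Lf\<bar> * norm (x - z)"
        by (rule order_trans[OF Lf[OF that] mult_right_mono]) auto
      show "onorm (\<lambda>h. DFs x h - DFs z h) \<le> \<bar>LF\<bar> * norm (x - z)"
        by (rule order_trans[OF LF[OF that] mult_right_mono]) auto
    qed (use f_deriv Fs_deriv that b(1) has_derivative_bounded_linear in auto)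
    then show ?thesis by (simp add: L_def algebra_simps)
  qed
  obtain C where C: "C > 0" and lin: "\<forall>y0\<in>NY0. \<forall>dy0. \<forall>dv. sq_int dv \<longrightarrow>
      unique_on_I (\<lambda>dy. Winf dy \<and> dy 0 = dy0 \<and> is_wderiv dy (\<lambda>t. DH (ystar y0 t) (dy t) + dv t)) \<and>
      (\<forall>dy. Winf dy \<and> dy 0 = dy0 \<and> is_wderiv dy (\<lambda>t. DH (ystar y0 t) (dy t) + dv t)
        \<longrightarrow> Wnorm dy \<le> C * (L2norm dv + norm dy0))"
    using Ass3 unfolding DH_def by blast
  have lin_ex: "\<exists>dy. Winf dy \<and> dy 0 = 0 \<and> is_wderiv dy (\<lambda>t. DH (ystar y0 t) (dy t) + dv t)"
    if "y0 \<in> NY0" "sq_int dv" for y0 dv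
    using lin[rule_format, OF that, of 0] unfolding unique_on_I_def by blast
  have lin_bound: "Wnorm dy \<le> C * (L2norm dv + norm (dy 0))"
    if "y0 \<in> NY0" "sq_int dv" "Winf dy" "is_wderiv dy (\<lambda>t. DH (ystar y0 t) (dy t) + dv t)" for y0 dv dy
    using lin[rule_format, OF that(1,2), of "dy 0"] that(3,4) by blast
  have ys_sol: "Winf (ystar y0)" "is_wderiv (ystar y0) (\<lambda>t. H (ystar y0 t))" "ystar y0 0 = y0"
    if "y0 \<in> NY0" for y0
    using A2 that unfolding cl_sol_def state_eq_def H_def by blast+
  have ys_le: "norm (ystar y0 t) \<le> Ci * (M * norm y0)" if "y0 \<in> NY0" "t \<ge> 0" for y0 t
  proof -
    have "norm (ystar y0 t) \<le> Ci * Wnorm (ystar y0)" using Ci_emb ys_sol(1) that by blast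
    also have "\<dots> \<le> Ci * (M * norm y0)"
      by (rule mult_left_mono) (use A3_bound that Ci_pos in auto)
    finally show ?thesis .
  qed

  \<comment> \<open>The correction has norm at most \<open>2 * C * b * \<epsilon> * MY0\<close>;
    adding 1 keeps \<open>c\<close> positive when \<open>MY0 = 0\<close>.\<close>
  define c where "c = 2 * C * b * MY0 + 1"
  \<comment> \<open>For \<open>\<epsilon> * D \<le> 1\<close> the nonnegative terms
    \<open>4 * (C * \<eta>)\<close> and \<open>8 * (C * C * L * Ci * MY0 * \<eta>)\<close> sum to at
    most 1. Each then contributes at most 1/4 to the contraction constant 1/2.\<close>
  define D where "D = 4 * C * b + 8 * C * C * L * Ci * b * MY0"
  have c: "c > 0" using C b(1) MY0 by (simp add: c_def add_nonneg_pos)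
  have D: "D > 0" using C b(1) L Ci_pos MY0 by (simp add: D_def add_pos_nonneg)
  have main: "\<exists>Y :: 'a \<Rightarrow> real \<Rightarrow> 'a.
      (\<forall>y0\<in>Y0.
         cl_sol f B (Fnet \<sigma> (\<theta> \<epsilon>)) y0 (Y y0) \<and> Wnorm (Y y0) \<le> 2 * MY0 \<and>
         (\<forall>z. cl_sol f B (Fnet \<sigma> (\<theta> \<epsilon>)) y0 z \<and> Wnorm z \<le> 2 * MY0
              \<longrightarrow> (\<forall>t\<ge>0. z t = Y y0 t)) \<and>
         Wnorm (ystar y0 - Y y0) \<le> c * \<epsilon> \<and>
         Wnorm (Y y0) \<le> 3/2 * M * norm y0) \<and>
      in_Linf_W \<mu> Y \<and> Linf_W_norm \<mu> Y \<le> ereal (3/2 * MY0)"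
    if \<epsilon>: "0 < \<epsilon>" "\<epsilon> < 1 / D" for \<epsilon>
  proof -
    define N where "N = (Fnet \<sigma> (\<theta> \<epsilon>) :: 'a \<Rightarrow> 'b)"
    define G where "G x = f x + B (N x)" for x
    define \<eta> where "\<eta> = b * \<epsilon>"
    have \<eta>: "\<eta> \<ge> 0" using b(1) \<epsilon> by (simp add: \<eta>_def)
    have "\<epsilon> * D \<le> 1" using \<epsilon> D by (simp add: pos_less_divide_eq)
    then have sum_le: "4 * (C * \<eta>) + 8 * (C * C * L * Ci * MY0 * \<eta>) \<le> 1"
      by (simp add: D_def \<eta>_def algebra_simps)
    have "C * \<eta> \<ge> 0" "C * C * L * Ci * MY0 * \<eta> \<ge> 0"
      using C \<eta> L Ci_pos MY0 by simp_all
    with sum_le have small1: "C * \<eta> \<le> 1/4" and small2: "C * C * L * Ci * MY0 * \<eta> \<le> 1/8" by auto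
    have G_diff: "norm ((G x - H x) - (G z - H z)) \<le> \<eta> * norm (x - z)"
      if "x \<in> cball 0 r" "z \<in> cball 0 r" for x z
    proof -
      have "norm ((Fs x - N x) - (Fs z - N z)) \<le> \<epsilon> * norm (x - z)"
        unfolding N_def
        by (rule eps_approx_lipschitz[OF \<sigma>_C1, where R=Mhat])
          (use \<theta>_approx \<epsilon> Fs_deriv that in \<open>auto simp: r_def\<close>)
      then have "b * norm ((Fs x - N x) - (Fs z - N z)) \<le> b * (\<epsilon> * norm (x - z))"
        using b(1) by simp
      moreover have "(G x - H x) - (G z - H z) = - B ((Fs x - N x) - (Fs z - N z))"
        by (simp add: G_def H_def linear_diff[OF B_lin])
      ultimately show ?thesis
        using b(2)[of "(Fs x - N x) - (Fs z - N z)"] by (simp add: \<eta>_def)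
    qed
    have G0: "G 0 = H 0" by (simp add: G_def H_def N_def Fnet_def Fs_0)
    \<comment> \<open>The stability constant \<open>C\<close> is uniform over \<open>NY0\<close>, so
      all initial values share the same constants.\<close>
    have PT: "perturbed_trajectory H G DH r L \<eta> C Ci (ystar y0)" if y0: "y0 \<in> Y0" for y0
    proof
      have y0N: "y0 \<in> NY0" using y0 N_sup by blast
      show "norm (ystar y0 t) \<le> r" if "t \<ge> 0" for t
      proof -
        have "Ci * (M * norm y0) \<le> Ci * MY0" using My0[OF y0] Ci_pos by simp
        moreover have "0 \<le> Ci * MY0" using MY0 Ci_pos by simp
        ultimately show ?thesis
          using ys_le[OF y0N that] unfolding r_def Mhat_def by linarith
      qed
      show "Winf (ystar y0)" "is_wderiv (ystar y0) (\<lambda>t. H (ystar y0 t))"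
        using ys_sol y0N by blast+
      show "\<exists>dy. Winf dy \<and> dy 0 = 0 \<and> is_wderiv dy (\<lambda>t. DH (ystar y0 t) (dy t) + dv t)"
        if "sq_int dv" for dv
        by (rule lin_ex[OF y0N that])
      show "Wnorm dy \<le> C * (L2norm dv + norm (dy 0))"
        if "sq_int dv" "Winf dy" "is_wderiv dy (\<lambda>t. DH (ystar y0 t) (dy t) + dv t)" for dv dy
        by (rule lin_bound[OF y0N that])
      show "norm (y t) \<le> Ci * Wnorm y" if "Winf y" "t \<ge> 0" for y :: "real \<Rightarrow> 'a" and t
        using Ci_emb that by blast
    qed (fact H_deriv DH_lip L \<eta> C Ci_pos G_diff G0)+

    \<comment> \<open>The self-mapping condition with \<open>L2norm (ystar y0)\<close> replaced by
      its bound \<open>M * norm y0\<close> dictates this radius. Its proportionality to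
      \<open>norm y0\<close> yields the factor 3/2 in the norm bound.\<close>
    define \<rho> where "\<rho> y0 = 2 * (C * \<eta>) * (M * norm y0)" for y0 :: 'a
    have \<rho>_le: "\<rho> y0 \<le> M * norm y0 / 2" "0 \<le> \<rho> y0" for y0
    proof -
      have "(C * \<eta>) * (M * norm y0) \<le> 1/4 * (M * norm y0)"
        using small1 M_pos by (intro mult_right_mono) auto
      then show "\<rho> y0 \<le> M * norm y0 / 2" by (simp add: \<rho>_def)
      show "0 \<le> \<rho> y0" using C \<eta> M_pos by (simp add: \<rho>_def)
    qed
    have \<rho>_le': "\<rho> y0 \<le> 2 * (C * \<eta>) * MY0" if "y0 \<in> Y0" for y0
      unfolding \<rho>_def by (rule mult_left_mono[OF My0[OF that]]) (use C \<eta> in simp)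
    have CL\<rho>: "C * (L * (Ci * \<rho> y0)) \<le> 1/4" if "y0 \<in> Y0" for y0
    proof -
      have "C * (L * (Ci * \<rho> y0)) \<le> C * (L * (Ci * (2 * (C * \<eta>) * MY0)))"
        using \<rho>_le'[OF that] C L Ci_pos by (intro mult_left_mono) auto
      also have "\<dots> = 2 * (C * C * L * Ci * MY0 * \<eta>)" by (simp add: algebra_simps)
      finally show ?thesis using small2 by linarith
    qed
    have "\<exists>w. Winf w \<and> w 0 = 0 \<and> Wnorm w \<le> \<rho> y0 \<and>
        is_wderiv (\<lambda>t. ystar y0 t + w t) (\<lambda>t. G (ystar y0 t + w t))" if y0: "y0 \<in> Y0" for y0
    proof (rule perturbed_trajectory.solution_exists[OF PT[OF y0]])
      have y0N: "y0 \<in> NY0" using y0 N_sup by blast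
      show "C * (L * (Ci * \<rho> y0) + \<eta>) \<le> 1/2"
        using CL\<rho>[OF y0] small1 by (simp add: distrib_left)
      have "L2norm (ystar y0) \<le> M * norm y0"
        using order_trans[OF L2norm_le_Wnorm] A3_bound y0N by blast
      then have "(C * \<eta>) * L2norm (ystar y0) \<le> (C * \<eta>) * (M * norm y0)"
        using C \<eta> by (intro mult_left_mono) auto
      then show "C * (\<eta> * L2norm (ystar y0)) \<le> \<rho> y0 / 2"
        by (simp add: \<rho>_def mult_ac)
      \<comment> \<open>The radius \<open>r\<close> is twice \<open>Ci * MY0\<close>: one half holds
        the optimal trajectory, the other the correction.\<close>
      show "norm (ystar y0 t) + Ci * \<rho> y0 \<le> r" if "t \<ge> 0" for t
      proof -
        have "\<rho> y0 \<le> MY0" using \<rho>_le(1)[of y0] My0[OF y0] MY0 by linarith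
        then have "Ci * \<rho> y0 \<le> Ci * MY0" "Ci * (M * norm y0) \<le> Ci * MY0"
          using My0[OF y0] Ci_pos by simp_all
        then show ?thesis
          using ys_le[OF y0N that] unfolding r_def Mhat_def by linarith
      qed
    qed
    then have "\<forall>y0\<in>Y0. \<exists>w. Winf w \<and> w 0 = 0 \<and> Wnorm w \<le> \<rho> y0 \<and>
        is_wderiv (\<lambda>t. ystar y0 t + w t) (\<lambda>t. G (ystar y0 t + w t))" by blast
    from bchoice[OF this] obtain w where "\<forall>y0\<in>Y0. Winf (w y0) \<and> w y0 0 = 0 \<and> Wnorm (w y0) \<le> \<rho> y0 \<and>
        is_wderiv (\<lambda>t. ystar y0 t + w y0 t) (\<lambda>t. G (ystar y0 t + w y0 t))" ..
    then have w: "\<And>y0. y0 \<in> Y0 \<Longrightarrow> Winf (w y0)" "\<And>y0. y0 \<in> Y0 \<Longrightarrow> w y0 0 = 0"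
      "\<And>y0. y0 \<in> Y0 \<Longrightarrow> Wnorm (w y0) \<le> \<rho> y0"
      "\<And>y0. y0 \<in> Y0 \<Longrightarrow> is_wderiv (\<lambda>t. ystar y0 t + w y0 t) (\<lambda>t. G (ystar y0 t + w y0 t))"
      by blast+
    define Y where "Y y0 t = ystar y0 t + w y0 t" for y0 t
    have Y_W: "Winf (Y y0)" and Y_3: "Wnorm (Y y0) \<le> 3/2 * M * norm y0"
      and Y_star: "Wnorm (ystar y0 - Y y0) \<le> c * \<epsilon>" and Y_0: "Y y0 0 = y0"
      and Y_deriv: "is_wderiv (Y y0) (\<lambda>t. G (Y y0 t))"
      and Y_near: "\<And>t. t \<ge> 0 \<Longrightarrow> norm (Y y0 t - ystar y0 t) \<le> Ci * \<rho> y0"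
      if y0: "y0 \<in> Y0" for y0
    proof -
      have y0N: "y0 \<in> NY0" using y0 N_sup by blast
      have eq: "Y y0 = (\<lambda>t. ystar y0 t + w y0 t)" by (simp add: Y_def fun_eq_iff)
      note add = Winf_add[OF ys_sol(1)[OF y0N] w(1)[OF y0]]
      show "Winf (Y y0)" unfolding eq by (rule add(1))
      have "Wnorm (Y y0) \<le> Wnorm (ystar y0) + Wnorm (w y0)" unfolding eq by (rule add(2))
      also have "\<dots> \<le> M * norm y0 + M * norm y0 / 2"
        using A3_bound y0N order_trans[OF w(3)[OF y0] \<rho>_le(1)] by (intro add_mono) auto
      finally show "Wnorm (Y y0) \<le> 3/2 * M * norm y0" by simp
      have "ystar y0 - Y y0 = (\<lambda>t. - w y0 t)" by (simp add: eq fun_eq_iff)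
      then have "Wnorm (ystar y0 - Y y0) = Wnorm (w y0)" using Winf_uminus(2)[OF w(1)[OF y0]] by simp
      also have "\<dots> \<le> 2 * (C * \<eta>) * MY0" using w(3)[OF y0] \<rho>_le'[OF y0] by linarith
      also have "\<dots> \<le> c * \<epsilon>" using \<epsilon> by (simp add: c_def \<eta>_def algebra_simps)
      finally show "Wnorm (ystar y0 - Y y0) \<le> c * \<epsilon>" .
      show "Y y0 0 = y0" by (simp add: Y_def w(2)[OF y0] ys_sol(3)[OF y0N])
      show "is_wderiv (Y y0) (\<lambda>t. G (Y y0 t))" unfolding eq by (rule w(4)[OF y0])
      fix t :: real assume t: "t \<ge> 0"
      have "norm (w y0 t) \<le> Ci * Wnorm (w y0)" using Ci_emb w(1)[OF y0] t by blast
      also have "\<dots> \<le> Ci * \<rho> y0" using w(3)[OF y0] Ci_pos by simp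
      finally show "norm (Y y0 t - ystar y0 t) \<le> Ci * \<rho> y0" by (simp add: Y_def)
    qed
    have Y_3': "Wnorm (Y y0) \<le> 3/2 * MY0" if "y0 \<in> Y0" for y0
      using Y_3[OF that] My0[OF that] by simp
    have Y_2: "Wnorm (Y y0) \<le> 2 * MY0" if "y0 \<in> Y0" for y0
      using Y_3'[OF that] MY0 by linarith
    \<comment> \<open>Every competitor in the uniqueness claim stays in the ball, where the Gronwall
      argument applies.\<close>
    have in_r: "norm (z t) \<le> r" if "Winf z" "Wnorm z \<le> 2 * MY0" "t \<ge> 0" for z :: "real \<Rightarrow> 'a" and t
    proof -
      have "norm (z t) \<le> Ci * Wnorm z" using Ci_emb that by blast
      also have "\<dots> \<le> Ci * (2 * MY0)" using that Ci_pos by simp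
      finally show ?thesis by (simp add: r_def Mhat_def)
    qed
    have cl: "cl_sol f B (Fnet \<sigma> (\<theta> \<epsilon>)) y0 z \<longleftrightarrow> Winf z \<and> z 0 = y0 \<and> is_wderiv z (\<lambda>t. G (z t))" for y0 z
      by (simp add: cl_sol_def state_eq_def G_def N_def)
    have unique: "z t = Y y0 t" if y0: "y0 \<in> Y0" and "cl_sol f B (Fnet \<sigma> (\<theta> \<epsilon>)) y0 z" "Wnorm z \<le> 2 * MY0" "t \<ge> 0" for y0 z t
      by (rule perturbed_trajectory.solution_unique[OF PT[OF y0]])
        (use that Y_deriv Y_0 in_r Y_W Y_2 in \<open>auto simp: cl\<close>)
    \<comment> \<open>\<open>Y x\<close> and \<open>Y z\<close> are compared through the
      linearization along \<open>ystar x\<close>, which \<open>Y z\<close> approaches by way of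
      \<open>ystar z\<close>. The allowance 3/4 is split equally among the corrections
      (\<open>q\<close>), the distance of the optimal trajectories (\<open>s\<close>) and the
      network error (\<open>\<eta>\<close>).\<close>
    have cont: "\<exists>d>0. \<forall>z\<in>Y0. dist x z < d \<longrightarrow> Wnorm (Y x - Y z) < e" if x: "x \<in> Y0" and e: "e > 0" for x e
    proof -
      have xN: "x \<in> NY0" using x N_sup by blast
      \<comment> \<open>The added 1 keeps the denominator positive even when \<open>L = 0\<close>,
        while \<open>C * L * s\<close> stays at most 1/4.\<close>
      define s where "s = 1 / (4 * (C * L + 1))"
      have CL: "C * L \<ge> 0" using C L by simp
      have s: "s > 0" "C * L * s \<le> 1/4" using CL by (simp_all add: s_def divide_simps)
      have "\<exists>d>0. \<forall>z. dist x z < d \<longrightarrow> (\<forall>t\<ge>0. norm (ystar z t - ystar x t) \<le> s)"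
        by (rule uniformly_close_if_differentiable[OF _ Ci_pos N_open xN, where D = "Dystar x"])
          (use Ci_emb ys_sol(1) A3_deriv xN s in auto)
      then obtain d where d: "d > 0" "\<And>z t. dist x z < d \<Longrightarrow> t \<ge> 0 \<Longrightarrow> norm (ystar z t - ystar x t) \<le> s"
        by blast
      have "Wnorm (Y x - Y z) < e" if z: "z \<in> Y0" and dist: "dist x z < min d (e / (4 * C))" for z
      proof -
        define q where "q = Ci * (2 * (C * \<eta>) * MY0)"
        have near: "norm (Y u t - ystar u t) \<le> q" if "u \<in> Y0" "t \<ge> 0" for u t
          using Y_near[OF that] mult_left_mono[OF \<rho>_le'[OF that(1)], of Ci] Ci_pos unfolding q_def by linarith
        have "Wnorm (Y x - Y z) \<le> 4 * C * norm (Y x 0 - Y z 0)"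
        proof (rule perturbed_trajectory.Wnorm_diff_le_initial[OF PT[OF x], where s = "q + s"])
          show "norm (Y x t - ystar x t) \<le> q + s" if "t \<ge> 0" for t
            using near[OF x that] s(1) by simp
          show "norm (Y z t - ystar x t) \<le> q + s" if "t \<ge> 0" for t
            using norm_triangle_ineq[of "Y z t - ystar z t" "ystar z t - ystar x t"]
              near[OF z that] d(2)[of z t] dist that by simp
          have "C * (L * q) = 2 * (C * C * L * Ci * MY0 * \<eta>)"
            by (simp add: q_def algebra_simps)
          then have "C * (L * q) \<le> 1/4" using small2 by linarith
          then show "C * (L * (q + s) + \<eta>) \<le> 3/4"
            using s(2) small1 by (simp add: algebra_simps)
        qed (use Y_W Y_deriv in_r Y_2 x z in auto)
        also have "\<dots> = 4 * C * dist x z" by (simp add: Y_0 x z dist_norm)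
        also have "\<dots> < e" using dist C by (simp add: pos_less_divide_eq mult.commute)
        finally show ?thesis .
      qed
      moreover have "min d (e / (4 * C)) > 0" using d(1) e C by simp
      ultimately show ?thesis by blast
    qed
    have meas: "strongly_measurable_W \<mu> Y"
      by (rule strongly_measurable_W_continuous[OF Y0_compact \<mu>_space \<mu>_borel Y_W cont])
    have Linf: "Linf_W_norm \<mu> Y \<le> ereal (3/2 * MY0)"
      by (rule Linf_W_norm_continuous_le[OF \<mu>_space \<mu>_borel Y_W cont Y_3'])
    then have "Linf_W_norm \<mu> Y < \<infinity>"
      by (rule le_less_trans) simp
    then have "in_Linf_W \<mu> Y"
      using meas unfolding in_Linf_W_def by blast
    moreover have "cl_sol f B (Fnet \<sigma> (\<theta> \<epsilon>)) y0 (Y y0)" if "y0 \<in> Y0" for y0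
      using Y_W Y_0 Y_deriv that by (simp add: cl)
    ultimately show ?thesis
      using Linf unique Y_2 Y_3 Y_star by (intro exI[of _ Y]) blast
  qed
  show ?thesis
    using D c main by (intro exI[of _ "1 / D"] conjI exI[of _ c]) auto
qed

end
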